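(* Let $a_2>a_1>0$, $c>0$, $A=a_2/a_1>1$, $K_2\in(0,1)$ and $n\in\mathbb{N}_0$. Let $m^0(n)$, $m^*(n)$, $m^{**}(n)$, $L_{nm}$, $M_{nm}^\pm$ and the notions of unimodal $(n,m)$-solution at $K_1$ and type II bimodal $(n,m)$-solution at $K_1$ (for the equation $\epsilon\dot u(t)=-u(t)-K_1u(t-a_1-cu(t))-K_2u(t-a_2-cu(t))$) be as defined in the context. Let $p\ge1$ be an integer. (i) If $p\in\bigl[m^0(n)+1,\ m^*(n)+\frac{1+K_2}{2+K_2}\bigr)$, then there exists $\delta>0$ such that for $K_1\in(L_{n,p-1},L_{n,p-1}+\delta)$ there is a) a leg of unimodal $(n,p-1)$-solutions, and b) a leg of type II bimodal $(n,p)$-solutions; and these solutions coincide at $K_1=L_{n,p-1}$. (ii) If $p\in\bigl(m^*(n)+\frac{1+K_2}{2+K_2},\ m^*(n)+1\bigr]$, then there exists $\delta>0$ such that a) for $K_1\in(L_{n,p-1},L_{n,p-1}+\delta)$ there is a leg of unimodal $(n,p-1)$-solutions, and b) for $K_1\in(L_{n,p-1}-\delta,L_{n,p-1})$ there is a leg of type II bimodal $(n,p)$-solutions; and these solutions coincide at $K_1=L_{n,p-1}$. (iii) If $p\in\Bigl(m^*(n)+1,\ \min\bigl(m^{**}(n)+1,(n+\tfrac12)(A-1)\bigr)\Bigr)$, then $1-K_2<L_{n,p-1}<1<M_{n,p-1}^-<M_{n,p-1}^+$ and there exists $\delta>0$ such that a) for $K_1\in(M_{n,p-1}^-,M_{n,p-1}^+)$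 there is a leg of unimodal $(n,p-1)$-solutions, and b) for $K_1\in(L_{n,p-1}-\delta,L_{n,p-1})$ there is a leg of type II bimodal $(n,p)$-solutions; and these solutions exist on disjoint parameter intervals. Here "a leg of solutions for $K_1$ in an interval" means that a solution of the stated kind exists at every $K_1$ in that interval, and "coincide at $K_1=L_{n,p-1}$" means that the limiting profiles and limiting periods of the two solutions as $K_1\to L_{n,p-1}$ (each from the side on which it exists) are identical.
   Context: $\mathbb{N}_0=\{0,1,2,\dots\}$; $m,n\in\mathbb{N}_0$. $m^0(n)$ is the unique integer in $(n(A-1)-1,n(A-1)]$; $$m^*(n)=n(A-1)+\frac{A-3-K_2}{2+K_2},\qquad L_{nm}=\frac{A-1}{m-n(A-1)+1}-(1+K_2),$$ $$m^{**}(n)=n(A-1)+\tfrac12\bigl[(A-1)\bigl((1+K_2)^2-K_2\bigr)+K_2\bigr]-\tfrac12\sqrt{\bigl(1+(1+K_2)^2\bigr)\bigl(((A-1)K_2+1)^2-1\bigr)},$$ $$G_{nm}(K_1)=\bigl[m-n(A-1)\bigr]\bigl((K_1+K_2)^2-1\bigr)-K_1\bigl[(A-1)(1+K_2)-K_2\bigr]+K_2(1+K_2)+(A-1).$$ When $G_{nm}$ has distinct roots they are denoted $M_{nm}^-<M_{nm}^+$. Unimodal $(n,m)$-solution at $K_1$: this exists if $K_1>1$ and, with $$T=\frac{a_1(1+K_1+K_2)+(a_2-a_1)K_2}{1+(m+1)K_2+n(1+K_1+K_2)},\qquad \theta=\frac{a_2-a_1}{T}-m,$$ one has $\theta\in\left(\frac{K_2}{K_1+K_2-1},1\right)$,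 and the equation has a periodic singular solution (defined below) of period $T>0$ with sawtooth profile: for each $i\in\mathbb{Z}$, $t(\mu)=(\mu-i)T$, $u(\mu)=\frac1c(-a_1+(n+\mu-2i)T)$ for $\mu\in[2i,2i+1]$, and $t(\mu)=(i+1)T$, $u(\mu)=\frac1c(-a_1+(n+1-(\mu-2i-1))T)$ for $\mu\in(2i+1,2i+2)$. Type II bimodal $(n,m)$-solution at $K_1$: this exists if $K_1>0$, $K_1+K_2>1$ and, with $$T=\frac{a_1(1+K_1+K_2)+(a_2-a_1)(1-K_1)}{1-m(K_1-1)+n(1+K_1+K_2)},\quad T_2=\frac{a_1H_{nm}(K_1)}{1-m(K_1-1)+n(1+K_1+K_2)},\quad T_1=T-T_2,\quad\theta=\frac{a_2-a_1-mT}{T_2},$$ $$H_{nm}(K_1)=\bigl[m-n(A-1)\bigr](K_1+K_2+1)(K_1+2K_2-1)-K_1\bigl[(A-1)(1+K_2)-K_2\bigr]+K_2(1+K_2)+(A-1)(1-K_2),$$ one has $T_2>0$, $\theta\in(0,1)$, $\theta<\frac{T_1}{T_2}+1-\frac1{K_2}$, and $\theta<\bigl(1-\frac{1}{K_1+K_2}\bigr)\frac{T_1}{T_2}$ if $K_1\ge1$, respectively $\theta<\min\bigl\{1-\frac{1-K_1}{K_1}\frac{T_1}{T_2},\bigl(1-\frac{K_1}{2K_1+K_2-1}\bigr)\frac{T_1}{T_2}\bigr\}$ if $K_1<1$; and the equation has a periodic singular solution of period $T>0$ with profile given for each $i\in\mathbb{Z}$ by: $\mu\in[4i,4i+1]$: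 $t=(\mu-4i)T_1+iT$, $u=\frac1c(-a_1+nT+(\mu-4i)T_1)$; $\mu\in[4i+1,4i+2]$: $t=T_1+iT$, $u=\frac1c(-a_1+nT+T_1-(\mu-4i-1)\theta T_2)$; $\mu\in[4i+2,4i+3]$: $t=(\mu-4i-2)T_2+T_1+iT$, $u=\frac1c(-a_1+nT+T_1-\theta T_2+(\mu-4i-2)T_2)$; $\mu\in[4i+3,4i+4]$: $t=(i+1)T$, $u=\frac1c(-a_1+nT+(T-\theta T_2)(4i+4-\mu))$. Here $T$ and $\theta$ for the two types of solution are defined by different formulas. "Profile" in the coincidence statement means the curve traced out in the $(t,u)$-plane. Admissible singular solution profile: a continuous injective parametric curve $\Gamma:I\to\mathbb{R}^2$, $\Gamma(\mu)=(t(\mu),u(\mu))$, on a nonempty interval $I\subseteq\mathbb{R}$, with $t$ monotonically increasing (not necessarily strictly). The interval $I$ is partitioned as $I=I^+\cup I^-\cup I^*$, where $I^*$ is a disjoint union of open intervals on each of which $t$ is strictly increasing, and $I^{\pm}$ are disjoint unions of closed intervals on each of which $t$ is constant, with $u$ strictly decreasing on each interval of $I^-$ and strictly increasing on each interval of $I^+$. Singular solution of $\epsilon\dot u(t)=-u(t)-K_1u(t-a_1-cu(t))-K_2u(t-a_2-cu(t))$ (an $\epsilon=0$ notion): let $\Gamma$ be an admissible singular solution profile on $I$, $J\subseteq\mathbb{R}$ a nonempty interval, and $\mu_0,\mu_1,\mu_2:J\to I$ continuous with $\mu_0$ monotonically increasing. Set $J^*=\mathrm{cl}\{\eta:\mu_0(\eta)\in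 I^*\}$, $J^\pm=\mathrm{int}\{\eta:\mu_0(\eta)\in I^\pm\}$ and $F(\eta)=-u(\mu_0(\eta))-K_1u(\mu_1(\eta))-K_2u(\mu_2(\eta))$. Then $\{\Gamma,\mu_0,\mu_1,\mu_2\}$ is a singular solution on $t(\mu_0(J))$ if $t(\mu_i(\eta))=t(\mu_0(\eta))-a_i-cu(\mu_0(\eta))$ for all $\eta\in J$, $i=1,2$, and $F=0$ on $J^*$, $F<0$ on $J^-$, $F>0$ on $J^+$. It is periodic if $J=\mathbb{R}$ and there exist $T>0$, $\eta_T>0$ with $t(\mu_i(\eta+\eta_T))=t(\mu_i(\eta))+T$ and $u(\mu_i(\eta+\eta_T))=u(\mu_i(\eta))$ for all $i=1,2$ and $\eta\in\mathbb{R}$; the period is the smallest such $T$.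
   Formalization: Part (ii) is stated with the extra condition p > n(A-1), and part (iii) with p-1 > n(A-1); for the excluded p the number L_{n,p-1} or the roots M^± are undefined, or the claim fails (L negative, respectively M^- < 1). *)

theory Defs
  imports "HOL-Analysis.Analysis"
begin

section \<open>Singular solutions\<close>

text \<open>
  A profile \<open>\<Gamma>\<close> has components \<open>t = fst \<circ> \<Gamma>\<close> and \<open>u = snd \<circ> \<Gamma>\<close>.  "Open" and "closed" are
  understood relative to the interval \<open>I\<close>.  The closed intervals that make up \<open>I_up\<close> and \<open>I_dn\<close> are
  nondegenerate: single points would satisfy the monotonicity conditions vacuously, and then every
  curve would be admissible with \<open>I_dn = I\<close>.
\<close>

definition admissible_profile ::
  "real set \<Rightarrow> real set \<Rightarrow> real set \<Rightarrow> real set \<Rightarrow> (real \<Rightarrow> real \<times> real) \<Rightarrow> bool" where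
  "admissible_profile I I_up I_dn I_st \<Gamma> \<longleftrightarrow>
     is_interval I \<and> I \<noteq> {} \<and> continuous_on I \<Gamma> \<and> inj_on \<Gamma> I \<and> mono_on I (fst \<circ> \<Gamma>) \<and>
     I = I_up \<union> I_dn \<union> I_st \<and> I_up \<inter> I_dn = {} \<and> I_up \<inter> I_st = {} \<and> I_dn \<inter> I_st = {} \<and>
     (\<exists>\<S>. disjoint \<S> \<and> \<Union>\<S> = I_st \<and>
        (\<forall>S\<in>\<S>. is_interval S \<and> openin (top_of_set I) S \<and> strict_mono_on S (fst \<circ> \<Gamma>))) \<and>
     (\<exists>\<S>. disjoint \<S> \<and> \<Union>\<S> = I_up \<and>
        (\<forall>S\<in>\<S>. is_interval S \<and> closedin (top_of_set I) S \<and> (\<exists>x\<in>S. \<exists>y\<in>S. x < y) \<and>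
           (fst \<circ> \<Gamma>) constant_on S \<and> strict_mono_on S (snd \<circ> \<Gamma>))) \<and>
     (\<exists>\<S>. disjoint \<S> \<and> \<Union>\<S> = I_dn \<and>
        (\<forall>S\<in>\<S>. is_interval S \<and> closedin (top_of_set I) S \<and> (\<exists>x\<in>S. \<exists>y\<in>S. x < y) \<and>
           (fst \<circ> \<Gamma>) constant_on S \<and> strict_antimono_on S (snd \<circ> \<Gamma>)))"

text \<open>
  Singular solutions of
  \<open>\<epsilon> u'(t) = - u(t) - K1 u(t - a1 - c u(t)) - K2 u(t - a2 - c u(t))\<close>, a notion for \<open>\<epsilon> = 0\<close>.
\<close>

definition singular_solution ::
  "real \<Rightarrow> real \<Rightarrow> real \<Rightarrow> real \<Rightarrow> real \<Rightarrow> real set \<Rightarrow> real set \<Rightarrow> (real \<Rightarrow> real \<times> real) \<Rightarrow>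
   (real \<Rightarrow> real) \<Rightarrow> (real \<Rightarrow> real) \<Rightarrow> (real \<Rightarrow> real) \<Rightarrow> bool" where
  "singular_solution a1 a2 c K1 K2 I J \<Gamma> \<mu>0 \<mu>1 \<mu>2 \<longleftrightarrow>
     (let t = fst \<circ> \<Gamma>; u = snd \<circ> \<Gamma>;
          F = (\<lambda>\<eta>. - u (\<mu>0 \<eta>) - K1 * u (\<mu>1 \<eta>) - K2 * u (\<mu>2 \<eta>))
      in \<exists>I_up I_dn I_st. admissible_profile I I_up I_dn I_st \<Gamma> \<and>
         is_interval J \<and> J \<noteq> {} \<and>
         \<mu>0 ` J \<subseteq> I \<and> \<mu>1 ` J \<subseteq> I \<and> \<mu>2 ` J \<subseteq> I \<and>
         continuous_on J \<mu>0 \<and> continuous_on J \<mu>1 \<and> continuous_on J \<mu>2 \<and> mono_on J \<mu>0 \<and>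
         (\<forall>\<eta>\<in>J. t (\<mu>1 \<eta>) = t (\<mu>0 \<eta>) - a1 - c * u (\<mu>0 \<eta>)) \<and>
         (\<forall>\<eta>\<in>J. t (\<mu>2 \<eta>) = t (\<mu>0 \<eta>) - a2 - c * u (\<mu>0 \<eta>)) \<and>
         (\<forall>\<eta> \<in> top_of_set J closure_of {\<eta>\<in>J. \<mu>0 \<eta> \<in> I_st}. F \<eta> = 0) \<and>
         (\<forall>\<eta> \<in> top_of_set J interior_of {\<eta>\<in>J. \<mu>0 \<eta> \<in> I_dn}. F \<eta> < 0) \<and>
         (\<forall>\<eta> \<in> top_of_set J interior_of {\<eta>\<in>J. \<mu>0 \<eta> \<in> I_up}. F \<eta> > 0))"

definition singular_periods ::
  "(real \<Rightarrow> real \<times> real) \<Rightarrow> (real \<Rightarrow> real) \<Rightarrow> (real \<Rightarrow> real) \<Rightarrow> real set" where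
  "singular_periods \<Gamma> \<mu>1 \<mu>2 =
     {T. T > 0 \<and> (\<exists>\<eta>T>0. \<forall>\<mu>\<in>{\<mu>1, \<mu>2}. \<forall>\<eta>.
           fst (\<Gamma> (\<mu> (\<eta> + \<eta>T))) = fst (\<Gamma> (\<mu> \<eta>)) + T \<and> snd (\<Gamma> (\<mu> (\<eta> + \<eta>T))) = snd (\<Gamma> (\<mu> \<eta>)))}"

definition periodic_singular_solution ::
  "real \<Rightarrow> real \<Rightarrow> real \<Rightarrow> real \<Rightarrow> real \<Rightarrow> real set \<Rightarrow> (real \<Rightarrow> real \<times> real) \<Rightarrow>
   (real \<Rightarrow> real) \<Rightarrow> (real \<Rightarrow> real) \<Rightarrow> (real \<Rightarrow> real) \<Rightarrow> real \<Rightarrow> bool" where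
  "periodic_singular_solution a1 a2 c K1 K2 I \<Gamma> \<mu>0 \<mu>1 \<mu>2 T \<longleftrightarrow>
     singular_solution a1 a2 c K1 K2 I UNIV \<Gamma> \<mu>0 \<mu>1 \<mu>2 \<and>
     T \<in> singular_periods \<Gamma> \<mu>1 \<mu>2 \<and> (\<forall>T'\<in>singular_periods \<Gamma> \<mu>1 \<mu>2. T \<le> T')"


section \<open>Thresholds, with \<open>A = a2 / a1\<close>\<close>

definition m_zero :: "real \<Rightarrow> nat \<Rightarrow> int" where
  "m_zero A n = (THE k. real n * (A - 1) - 1 < of_int k \<and> of_int k \<le> real n * (A - 1))"

definition m_star :: "real \<Rightarrow> real \<Rightarrow> nat \<Rightarrow> real" where
  "m_star A K2 n = real n * (A - 1) + (A - 3 - K2) / (2 + K2)"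

definition m_star2 :: "real \<Rightarrow> real \<Rightarrow> nat \<Rightarrow> real" where
  "m_star2 A K2 n = real n * (A - 1) + 1/2 * ((A - 1) * ((1 + K2)\<^sup>2 - K2) + K2)
     - 1/2 * sqrt ((1 + (1 + K2)\<^sup>2) * (((A - 1) * K2 + 1)\<^sup>2 - 1))"

definition L_bound :: "real \<Rightarrow> real \<Rightarrow> nat \<Rightarrow> nat \<Rightarrow> real" where
  "L_bound A K2 n m = (A - 1) / (real m - real n * (A - 1) + 1) - (1 + K2)"

definition G_fun :: "real \<Rightarrow> real \<Rightarrow> nat \<Rightarrow> nat \<Rightarrow> real \<Rightarrow> real" where
  "G_fun A K2 n m K1 = (real m - real n * (A - 1)) * ((K1 + K2)\<^sup>2 - 1)
     - K1 * ((A - 1) * (1 + K2) - K2) + K2 * (1 + K2) + (A - 1)"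

text \<open>
  \<open>M_minus\<close> and \<open>M_plus\<close> are meaningful only if \<open>G_fun A K2 n m\<close> has two distinct real roots.
  For \<open>m = n (A - 1)\<close> the function is affine, and for \<open>m < n (A - 1)\<close> it is concave, in which case
  unimodal solutions do not live between the roots.  Likewise \<open>L_bound A K2 n m\<close> is negative or
  undefined unless \<open>m + 1 > n (A - 1)\<close>.
\<close>

definition M_minus :: "real \<Rightarrow> real \<Rightarrow> nat \<Rightarrow> nat \<Rightarrow> real" where
  "M_minus A K2 n m = (THE x. \<exists>y. x < y \<and> {K1. G_fun A K2 n m K1 = 0} = {x, y})"

definition M_plus :: "real \<Rightarrow> real \<Rightarrow> nat \<Rightarrow> nat \<Rightarrow> real" where
  "M_plus A K2 n m = (THE y. \<exists>x. x < y \<and> {K1. G_fun A K2 n m K1 = 0} = {x, y})"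


section \<open>Unimodal solutions\<close>

definition uni_T :: "real \<Rightarrow> real \<Rightarrow> real \<Rightarrow> nat \<Rightarrow> nat \<Rightarrow> real \<Rightarrow> real" where
  "uni_T a1 a2 K2 n m K1 =
     (a1 * (1 + K1 + K2) + (a2 - a1) * K2) / (1 + (real m + 1) * K2 + real n * (1 + K1 + K2))"

definition uni_theta :: "real \<Rightarrow> real \<Rightarrow> real \<Rightarrow> nat \<Rightarrow> nat \<Rightarrow> real \<Rightarrow> real" where
  "uni_theta a1 a2 K2 n m K1 = (a2 - a1) / uni_T a1 a2 K2 n m K1 - real m"

text \<open>The index \<open>i\<close> is the integer with \<open>2 i \<le> \<mu> < 2 i + 2\<close>.\<close>

definition uni_profile ::
  "real \<Rightarrow> real \<Rightarrow> real \<Rightarrow> real \<Rightarrow> nat \<Rightarrow> nat \<Rightarrow> real \<Rightarrow> real \<Rightarrow> real \<times> real" where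
  "uni_profile a1 a2 c K2 n m K1 \<mu> =
     (let T = uni_T a1 a2 K2 n m K1; i = of_int \<lfloor>\<mu> / 2\<rfloor>
      in if \<mu> \<le> 2 * i + 1
         then ((\<mu> - i) * T, 1 / c * (- a1 + (real n + \<mu> - 2 * i) * T))
         else ((i + 1) * T, 1 / c * (- a1 + (real n + 1 - (\<mu> - 2 * i - 1)) * T)))"

definition unimodal_solution ::
  "real \<Rightarrow> real \<Rightarrow> real \<Rightarrow> real \<Rightarrow> nat \<Rightarrow> nat \<Rightarrow> real \<Rightarrow> bool" where
  "unimodal_solution a1 a2 c K2 n m K1 \<longleftrightarrow>
     K1 > 1 \<and>
     K2 / (K1 + K2 - 1) < uni_theta a1 a2 K2 n m K1 \<and> uni_theta a1 a2 K2 n m K1 < 1 \<and>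
     (\<exists>\<mu>0 \<mu>1 \<mu>2. periodic_singular_solution a1 a2 c K1 K2 UNIV
        (uni_profile a1 a2 c K2 n m K1) \<mu>0 \<mu>1 \<mu>2 (uni_T a1 a2 K2 n m K1))"


section \<open>Type II bimodal solutions\<close>

definition H_fun :: "real \<Rightarrow> real \<Rightarrow> nat \<Rightarrow> nat \<Rightarrow> real \<Rightarrow> real" where
  "H_fun A K2 n m K1 = (real m - real n * (A - 1)) * (K1 + K2 + 1) * (K1 + 2 * K2 - 1)
     - K1 * ((A - 1) * (1 + K2) - K2) + K2 * (1 + K2) + (A - 1) * (1 - K2)"

definition bi_T :: "real \<Rightarrow> real \<Rightarrow> real \<Rightarrow> nat \<Rightarrow> nat \<Rightarrow> real \<Rightarrow> real" where
  "bi_T a1 a2 K2 n m K1 =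
     (a1 * (1 + K1 + K2) + (a2 - a1) * (1 - K1)) /
     (1 - real m * (K1 - 1) + real n * (1 + K1 + K2))"

definition bi_T2 :: "real \<Rightarrow> real \<Rightarrow> real \<Rightarrow> nat \<Rightarrow> nat \<Rightarrow> real \<Rightarrow> real" where
  "bi_T2 a1 a2 K2 n m K1 =
     a1 * H_fun (a2 / a1) K2 n m K1 / (1 - real m * (K1 - 1) + real n * (1 + K1 + K2))"

definition bi_T1 :: "real \<Rightarrow> real \<Rightarrow> real \<Rightarrow> nat \<Rightarrow> nat \<Rightarrow> real \<Rightarrow> real" where
  "bi_T1 a1 a2 K2 n m K1 = bi_T a1 a2 K2 n m K1 - bi_T2 a1 a2 K2 n m K1"

definition bi_theta :: "real \<Rightarrow> real \<Rightarrow> real \<Rightarrow> nat \<Rightarrow> nat \<Rightarrow> real \<Rightarrow> real" where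
  "bi_theta a1 a2 K2 n m K1 =
     (a2 - a1 - real m * bi_T a1 a2 K2 n m K1) / bi_T2 a1 a2 K2 n m K1"

text \<open>The index \<open>i\<close> is the integer with \<open>4 i \<le> \<mu> < 4 i + 4\<close>.\<close>

definition bi_profile ::
  "real \<Rightarrow> real \<Rightarrow> real \<Rightarrow> real \<Rightarrow> nat \<Rightarrow> nat \<Rightarrow> real \<Rightarrow> real \<Rightarrow> real \<times> real" where
  "bi_profile a1 a2 c K2 n m K1 \<mu> =
     (let T = bi_T a1 a2 K2 n m K1; T1 = bi_T1 a1 a2 K2 n m K1; T2 = bi_T2 a1 a2 K2 n m K1;
          \<theta> = bi_theta a1 a2 K2 n m K1; i = of_int \<lfloor>\<mu> / 4\<rfloor>
      in if \<mu> \<le> 4 * i + 1 then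
           ((\<mu> - 4 * i) * T1 + i * T,
            1 / c * (- a1 + real n * T + (\<mu> - 4 * i) * T1))
         else if \<mu> \<le> 4 * i + 2 then
           (T1 + i * T,
            1 / c * (- a1 + real n * T + T1 - (\<mu> - 4 * i - 1) * \<theta> * T2))
         else if \<mu> \<le> 4 * i + 3 then
           ((\<mu> - 4 * i - 2) * T2 + T1 + i * T,
            1 / c * (- a1 + real n * T + T1 - \<theta> * T2 + (\<mu> - 4 * i - 2) * T2))
         else
           ((i + 1) * T,
            1 / c * (- a1 + real n * T + (T - \<theta> * T2) * (4 * i + 4 - \<mu>))))"

definition bimodal2_solution ::
  "real \<Rightarrow> real \<Rightarrow> real \<Rightarrow> real \<Rightarrow> nat \<Rightarrow> nat \<Rightarrow> real \<Rightarrow> bool" where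
  "bimodal2_solution a1 a2 c K2 n m K1 \<longleftrightarrow>
     (let T = bi_T a1 a2 K2 n m K1; T1 = bi_T1 a1 a2 K2 n m K1; T2 = bi_T2 a1 a2 K2 n m K1;
          \<theta> = bi_theta a1 a2 K2 n m K1
      in K1 > 0 \<and> K1 + K2 > 1 \<and> T2 > 0 \<and> 0 < \<theta> \<and> \<theta> < 1 \<and>
         \<theta> < T1 / T2 + 1 - 1 / K2 \<and>
         (K1 \<ge> 1 \<longrightarrow> \<theta> < (1 - 1 / (K1 + K2)) * (T1 / T2)) \<and>
         (K1 < 1 \<longrightarrow> \<theta> < min (1 - (1 - K1) / K1 * (T1 / T2))
                            ((1 - K1 / (2 * K1 + K2 - 1)) * (T1 / T2))) \<and>
         (\<exists>\<mu>0 \<mu>1 \<mu>2. periodic_singular_solution a1 a2 c K1 K2 UNIV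
            (bi_profile a1 a2 c K2 n m K1) \<mu>0 \<mu>1 \<mu>2 T))"


section \<open>Legs of solutions\<close>

definition leg :: "(real \<Rightarrow> bool) \<Rightarrow> real set \<Rightarrow> bool" where
  "leg sol S \<longleftrightarrow> (\<forall>K1\<in>S. sol K1)"

text \<open>
  Two families of periods and profiles, depending on \<open>K1\<close>, coincide in the limit along the filters
  \<open>F\<close> and \<open>F'\<close> (one-sided limits in \<open>K1\<close>): the parametrised profiles converge locally uniformly,
  the limit curves have the same trace in the \<open>(t, u)\<close>-plane, and the limiting periods agree.
\<close>

definition coincide_in_limit ::
  "(real \<Rightarrow> real) \<Rightarrow> (real \<Rightarrow> real \<Rightarrow> real \<times> real) \<Rightarrow> real filter \<Rightarrow>
   (real \<Rightarrow> real) \<Rightarrow> (real \<Rightarrow> real \<Rightarrow> real \<times> real) \<Rightarrow> real filter \<Rightarrow> bool" where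
  "coincide_in_limit T \<Gamma> F T' \<Gamma>' F' \<longleftrightarrow>
     (\<exists>T0 \<Gamma>0 \<Gamma>0'. (T \<longlongrightarrow> T0) F \<and> (T' \<longlongrightarrow> T0) F' \<and>
        (\<forall>C. compact C \<longrightarrow> uniform_limit C \<Gamma> \<Gamma>0 F \<and> uniform_limit C \<Gamma>' \<Gamma>0' F') \<and>
        range \<Gamma>0 = range \<Gamma>0')"

end

theory Submission
  imports Defs
begin

text \<open>
  Both kinds of profile are polygonal curves in the \<open>(t, u)\<close>-plane whose edges alternate between a rise of slope
  \<open>1 / c\<close> and a vertical drop.  Along a rise the delayed times \<open>t - a\<^sub>j - c u\<close> stand still; along a drop they
  advance at the rate at which \<open>c u\<close> falls.  So while \<open>\<mu>0\<close> climbs, a delayed point can only wait or slide along a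
  vertical edge (this is how \<open>F = 0\<close> is maintained), and while \<open>\<mu>0\<close> descends, the delayed points move
  forward along the rises; \<open>\<mu>0\<close> has to pause whenever one of them reaches a drop.  All three parametrisations
  are therefore piecewise linear with finitely many nodes per period, and so is \<open>F\<close>.  Hence a singular solution can be
  verified at the nodes alone: \<open>F\<close> must vanish at the ends of every rise and be negative at the other nodes
  (\<open>zigzag_periodic_singular_solution\<close>).  For the sawtooth five nodes per period suffice, for the curve with two teeth
  ten (\<open>sawtooth_solution\<close>, \<open>two_tooth_solution\<close>); the inequalities on \<open>\<theta>\<close> come out as the signs of
  \<open>F\<close> at these nodes, together with the condition that the delayed points fit on the vertical edge on which they slide.

  The rest is algebra in the excess \<open>x = p - n (A - 1)\<close>, which is positive in all three cases, and \<open>d = A - 1\<close>.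
  For unimodal \<open>(n, p - 1)\<close>-solutions the condition \<open>\<theta> < 1\<close> says \<open>K1 > L\<close> and the lower bound on \<open>\<theta>\<close> says
  \<open>G < 0\<close>.  For bimodal \<open>(n, p)\<close>-solutions with common denominator \<open>D\<close> one has
  \<open>\<theta> T\<^sub>2 D = - a1 x (K1 - L)\<close>, while \<open>x D(L) = p (1 + x (2 + K2) - d)\<close>.  As \<open>K1 \<rightarrow> L\<close>, the height \<open>\<theta> T\<^sub>2\<close> of
  the intermediate drop tends to \<open>0\<close>, \<open>T\<close> to \<open>(a2 - a1) / p\<close> and \<open>T\<^sub>2\<close> to \<open>K2 T\<close>; apart from \<open>\<theta> > 0\<close> every strict inequality
  but one survives in the limit, and that one (\<open>\<theta> < T\<^sub>1 / T\<^sub>2 + 1 - 1 / K2\<close>) is equivalent to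
  \<open>K1 + K2 > 1\<close> as soon as \<open>\<theta> > 0\<close>.  Thus the bimodal leg lies to the right of \<open>L\<close> if \<open>D(L) < 0\<close> and to the left if
  \<open>D(L) > 0\<close>, which is the distinction between (i) and the other two cases, and the limit curve is the sawtooth.  Since
  \<open>L \<ge> 1\<close> says \<open>x (2 + K2) \<le> d\<close>, the unimodal leg reaches \<open>L\<close> in (i) and (ii).  In (iii), \<open>G\<close> is a convex
  quadratic with positive value and negative slope at \<open>1\<close>, and \<open>p < m\<^sup>*\<^sup>*(n) + 1\<close> makes its discriminant positive, so that both
  roots exceed \<open>1\<close>.
\<close>

section \<open>Piecewise linear interpolation\<close>

definition polyline :: "(int \<Rightarrow> 'a::real_vector) \<Rightarrow> real \<Rightarrow> 'a" where
  "polyline x s = x \<lfloor>s\<rfloor> + frac s *\<^sub>R (x (\<lfloor>s\<rfloor> + 1) - x \<lfloor>s\<rfloor>)"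

lemma polyline_cell:
  assumes "of_int j \<le> s" "s \<le> of_int j + 1"
  shows "polyline x s = x j + (s - of_int j) *\<^sub>R (x (j + 1) - x j)"
proof (cases "s = of_int j + 1")
  case True
  then have "\<lfloor>s\<rfloor> = j + 1" by simp
  with True show ?thesis by (simp add: polyline_def frac_def)
next
  case False
  then have "\<lfloor>s\<rfloor> = j" using assms by (simp add: floor_unique)
  then show ?thesis by (simp add: polyline_def frac_def)
qed

lemma polyline_of_int [simp]: "polyline x (of_int k) = x k"
  by (simp add: polyline_def)

lemma fst_polyline: "fst (polyline V s) = polyline (\<lambda>k. fst (V k)) s"
  by (simp add: polyline_def)

lemma snd_polyline: "snd (polyline V s) = polyline (\<lambda>k. snd (V k)) s"
  by (simp add: polyline_def)

lemma polyline_diff: "polyline x s - polyline y s = polyline (\<lambda>k. x k - y k) s"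
  by (simp add: polyline_def algebra_simps)

lemma polyline_cmult:
  fixes x :: "int \<Rightarrow> real" shows "a * polyline x s = polyline (\<lambda>k. a * x k) s"
  by (simp add: polyline_def algebra_simps)

lemma polyline_uminus: "- polyline x s = polyline (\<lambda>k. - x k) s"
  by (simp add: polyline_def algebra_simps)

lemma polyline_const: "polyline (\<lambda>k. a) s = a"
  by (simp add: polyline_def)

lemma continuous_polyline:
  fixes x :: "int \<Rightarrow> 'a::real_normed_vector"
  shows "continuous_on S (polyline x)"
proof -
  have "isCont (polyline x) s" for s
  proof -
    define k where "k = \<lfloor>s\<rfloor>"
    \<comment> \<open>On the two cells around a node the interpolant is a sum of a left and a right ramp.\<close>
    define U where "U = {real_of_int k - 1 <..< of_int k + 1}"
    define g where "g = (\<lambda>r. x k + max 0 (r - of_int k) *\<^sub>R (x (k + 1) - x k)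
                             + min 0 (r - of_int k) *\<^sub>R (x k - x (k - 1)))"
    have eq: "polyline x r = g r" if "r \<in> U" for r
    proof (cases "of_int k \<le> r")
      case True
      then show ?thesis using polyline_cell[of k r x] that by (simp add: g_def U_def)
    next
      case False
      then have "polyline x r = x (k - 1) + (r - of_int k + 1) *\<^sub>R (x k - x (k - 1))"
        using polyline_cell[of "k - 1" r x] that by (simp add: U_def algebra_simps)
      then show ?thesis using False by (simp add: g_def algebra_simps)
    qed
    have "continuous_on U g" unfolding g_def by (intro continuous_intros)
    then have "continuous_on U (polyline x)" by (rule continuous_on_eq) (simp add: eq)
    moreover have "s \<in> U" unfolding U_def k_def greaterThanLessThan_iff by linarith
    moreover have "open U" by (simp add: U_def)
    ultimately show ?thesis by (simp add: continuous_on_eq_continuous_at)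
  qed
  then show ?thesis by (simp add: continuous_at_imp_continuous_on)
qed

lemma int_step_mono:
  fixes x :: "int \<Rightarrow> real"
  assumes "\<And>k. x k \<le> x (k + 1)" "j \<le> k" shows "x j \<le> x k"
  using assms(2) by (induction k rule: int_ge_induct) (auto intro: order_trans assms(1))

lemma polyline_between:
  fixes x :: "int \<Rightarrow> real"
  assumes "\<And>k. x k \<le> x (k + 1)"
  shows "x \<lfloor>s\<rfloor> \<le> polyline x s" "polyline x s \<le> x (\<lfloor>s\<rfloor> + 1)"
  using assms[of "\<lfloor>s\<rfloor>"] frac_lt_1[of s] mult_left_le_one_le[of "x (\<lfloor>s\<rfloor> + 1) - x \<lfloor>s\<rfloor>" "frac s"]
  by (auto simp: polyline_def)

lemma polyline_mono:
  fixes x :: "int \<Rightarrow> real"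
  assumes step: "\<And>k. x k \<le> x (k + 1)" and "s \<le> s'"
  shows "polyline x s \<le> polyline x s'"
proof (cases "\<lfloor>s\<rfloor> = \<lfloor>s'\<rfloor>")
  case True
  then have "frac s \<le> frac s'" using assms(2) by (simp add: frac_def)
  then show ?thesis using step[of "\<lfloor>s'\<rfloor>"] True by (auto simp: polyline_def intro: mult_right_mono)
next
  case False
  then have "\<lfloor>s\<rfloor> + 1 \<le> \<lfloor>s'\<rfloor>" using floor_mono[OF assms(2)] by linarith
  then show ?thesis
    using polyline_between[where x = x, OF step, of s] polyline_between[where x = x, OF step, of s'] int_step_mono[of x, OF step]
    by (meson order_trans)
qed

lemma polyline_strict_mono:
  fixes x :: "int \<Rightarrow> real"
  assumes step: "\<And>k. x k < x (k + 1)" and "s < s'"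
  shows "polyline x s < polyline x s'"
proof (cases "\<lfloor>s\<rfloor> = \<lfloor>s'\<rfloor>")
  case True
  then have "frac s < frac s'" using assms(2) by (simp add: frac_def)
  then show ?thesis using step[of "\<lfloor>s'\<rfloor>"] True by (auto simp: polyline_def intro: mult_strict_right_mono)
next
  case False
  then have *: "\<lfloor>s\<rfloor> + 1 \<le> \<lfloor>s'\<rfloor>" using floor_mono[of s s'] assms(2) by linarith
  have "frac s * (x (\<lfloor>s\<rfloor> + 1) - x \<lfloor>s\<rfloor>) < 1 * (x (\<lfloor>s\<rfloor> + 1) - x \<lfloor>s\<rfloor>)"
    using step[of "\<lfloor>s\<rfloor>"] frac_lt_1[of s] by (intro mult_strict_right_mono) auto
  then have "polyline x s < x (\<lfloor>s\<rfloor> + 1)" by (simp add: polyline_def)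
  then show ?thesis
    using polyline_between[where x = x, OF less_imp_le[OF step], of s'] int_step_mono[of x, OF less_imp_le[OF step] *]
    by linarith
qed

lemma polyline_shift:
  assumes "\<And>k. x (k + N) = x k + q"
  shows "polyline x (s + of_int N) = polyline x s + q"
proof -
  have "x (\<lfloor>s\<rfloor> + N + 1) = x (\<lfloor>s\<rfloor> + 1) + q" using assms[of "\<lfloor>s\<rfloor> + 1"] by (simp add: algebra_simps)
  then show ?thesis by (simp add: polyline_def assms frac_def)
qed

text \<open>
  Composition stays piecewise linear as long as each edge of the inner path remains inside one cell
  \<open>[j, j + 1]\<close>, where the outer path is affine.
\<close>

lemma polyline_compose:
  fixes x :: "int \<Rightarrow> real"
  assumes "\<And>k. \<exists>j. {x k, x (k + 1)} \<subseteq> {of_int j..of_int j + 1}"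
  shows "polyline V (polyline x s) = polyline (\<lambda>k. polyline V (x k)) s"
proof -
  define k where "k = \<lfloor>s\<rfloor>"
  obtain j where j: "{x k, x (k + 1)} \<subseteq> {of_int j..of_int j + 1}" using assms by blast
  have f: "0 \<le> frac s" "frac s \<le> 1" using frac_lt_1[of s] by auto
  have conv: "polyline x s = (1 - frac s) * x k + frac s * x (k + 1)"
    by (simp add: polyline_def k_def algebra_simps)
  have "polyline x s \<in> {of_int j..of_int j + 1}"
    unfolding conv using f j convexD[OF convex_closed_interval, of "x k" _ _ "x (k+1)" "1 - frac s" "frac s"]
    by auto
  then have a: "polyline V (polyline x s) = V j + (polyline x s - of_int j) *\<^sub>R (V (j + 1) - V j)"
    by (intro polyline_cell) auto
  have b: "polyline V (x k) = V j + (x k - of_int j) *\<^sub>R (V (j + 1) - V j)"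
    "polyline V (x (k + 1)) = V j + (x (k + 1) - of_int j) *\<^sub>R (V (j + 1) - V j)"
    using j by (auto intro!: polyline_cell)
  show ?thesis
    unfolding a polyline_def[of "\<lambda>k. polyline V (x k)"] k_def[symmetric] b
    unfolding conv
    by (simp add: algebra_simps)
qed

text \<open>
  Only finitely many nodes matter on a bounded set, and on each cell the distance of two interpolants is
  at most the larger distance at the two ends.
\<close>

lemma polyline_uniform_limit:
  fixes X :: "'b \<Rightarrow> int \<Rightarrow> 'a::real_normed_vector"
  assumes lim: "\<And>k. ((\<lambda>K. X K k) \<longlongrightarrow> Y k) F" and "bounded C"
  shows "uniform_limit C (\<lambda>K. polyline (X K)) (polyline Y) F"
proof (rule uniform_limitI)
  fix e :: real assume e: "0 < e"
  obtain B where B: "\<And>s. s \<in> C \<Longrightarrow> \<bar>s\<bar> \<le> B" using \<open>bounded C\<close> by (auto simp: bounded_iff)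
  define M where "M = {\<lfloor>- B\<rfloor>..\<lfloor>B\<rfloor> + 1}"
  have "\<forall>\<^sub>F K in F. \<forall>k\<in>M. dist (X K k) (Y k) < e"
    using lim e by (intro eventually_ball_finite) (auto simp: M_def tendsto_iff)
  then show "\<forall>\<^sub>F K in F. \<forall>s\<in>C. dist (polyline (X K) s) (polyline Y s) < e"
  proof eventually_elim
    case (elim K)
    show ?case
    proof
      fix s assume "s \<in> C"
      then have s: "- B \<le> s" "s \<le> B" using B[of s] by auto
      have mem: "\<lfloor>s\<rfloor> \<in> M" "\<lfloor>s\<rfloor> + 1 \<in> M" using floor_mono[OF s(1)] floor_mono[OF s(2)] by (auto simp: M_def)
      let ?D = "\<lambda>k. Y k - X K k"
      have D: "norm (?D \<lfloor>s\<rfloor>) < e" "norm (?D (\<lfloor>s\<rfloor> + 1)) < e" using elim mem by (auto simp: dist_norm norm_minus_commute)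
      have "polyline Y s - polyline (X K) s = (1 - frac s) *\<^sub>R ?D \<lfloor>s\<rfloor> + frac s *\<^sub>R ?D (\<lfloor>s\<rfloor> + 1)"
        by (simp add: polyline_def algebra_simps)
      also have "\<dots> \<in> ball 0 e"
        using D frac_lt_1[of s] by (intro convexD[OF convex_ball]) auto
      finally show "dist (polyline (X K) s) (polyline Y s) < e" by (simp add: dist_norm)
    qed
  qed
qed

section \<open>Zigzag curves and their singular solutions\<close>

lemma disjoint_unit_cells:
  assumes "\<And>i i' s. s \<in> S i \<Longrightarrow> s \<in> S i' \<Longrightarrow> i = (i' :: int)"
  shows "disjoint (range S)"
  using assms by (auto simp: pairwise_def disjnt_iff)

lemma rise_drop_disjoint:
  "(\<Union>i::int. {2 * real_of_int i<..<2 * of_int i + 1}) \<inter> (\<Union>i::int. {2 * real_of_int i + 1..2 * of_int i + 2}) = {}"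
proof -
  have False if "2 * real_of_int i < s" "s < 2 * of_int i + 1" "2 * real_of_int j + 1 \<le> s" "s \<le> 2 * of_int j + 2"
    for i j s
  proof -
    have "i < j + 1" "j < i" using that by linarith+
    then show False by simp
  qed
  then show ?thesis by fastforce
qed

text \<open>
  Neither \<open>t\<close> nor \<open>u\<close> is strictly monotone along a zigzag, but \<open>2 t - c u = t + (t - c u)\<close> is: the first summand
  increases on rises and is constant on drops, and the second behaves the other way round.  This gives injectivity.
\<close>

lemma zigzag_admissible:
  fixes V :: "int \<Rightarrow> real \<times> real" and c :: real
  assumes c: "0 < c"
    and rise: "\<And>i. fst (V (2 * i)) < fst (V (2 * i + 1))"
      "\<And>i. c * (snd (V (2 * i + 1)) - snd (V (2 * i))) = fst (V (2 * i + 1)) - fst (V (2 * i))"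
    and drop: "\<And>i. fst (V (2 * i + 2)) = fst (V (2 * i + 1))"
      "\<And>i. snd (V (2 * i + 2)) < snd (V (2 * i + 1))"
  shows "admissible_profile UNIV {} (\<Union>i::int. {2 * of_int i + 1..2 * of_int i + 2})
           (\<Union>i::int. {2 * of_int i<..<2 * of_int i + 1}) (polyline V)"
proof -
  let ?dn = "\<lambda>i::int. {2 * real_of_int i + 1..2 * of_int i + 2}"
  let ?st = "\<lambda>i::int. {2 * real_of_int i<..<2 * of_int i + 1}"
  have parity: "\<exists>i. k = 2 * i \<or> k = 2 * i + 1" for k :: int by presburger
  have t_step: "fst (V k) \<le> fst (V (k + 1))" for k
    using parity[of k] rise(1) drop(1) by (auto simp: algebra_simps intro: less_imp_le)
  have h_step: "2 * fst (V k) - c * snd (V k) < 2 * fst (V (k + 1)) - c * snd (V (k + 1))" for k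
  proof -
    obtain i where "k = 2 * i \<or> k = 2 * i + 1" using parity by blast
    then show ?thesis
    proof
      assume "k = 2 * i"
      then show ?thesis using rise[of i] by (simp add: algebra_simps)
    next
      assume "k = 2 * i + 1"
      then show ?thesis using drop[of i] c by (simp add: algebra_simps)
    qed
  qed
  have mono: "mono_on UNIV (fst \<circ> polyline V)"
    by (auto intro!: mono_onI polyline_mono t_step simp: fst_polyline)
  have "polyline V s \<noteq> polyline V s'" if "s < s'" for s s'
  proof -
    have "2 * fst (polyline V r) - c * snd (polyline V r)
        = polyline (\<lambda>k. 2 * fst (V k) - c * snd (V k)) r" for r
      by (simp add: fst_polyline snd_polyline polyline_cmult polyline_diff)
    then show ?thesis using polyline_strict_mono[where x = "\<lambda>k. 2 * fst (V k) - c * snd (V k)", OF h_step that]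
      by (metis less_irrefl)
  qed
  then have inj: "inj (polyline V)" by (metis injI linorder_neqE)
  have on_dn: "polyline V s = V (2 * i + 1) + (s - (2 * of_int i + 1)) *\<^sub>R (V (2 * i + 2) - V (2 * i + 1))"
    if "s \<in> ?dn i" for s i using polyline_cell[of "2 * i + 1" s V] that by (simp add: add.assoc)
  have on_st: "polyline V s = V (2 * i) + (s - 2 * of_int i) *\<^sub>R (V (2 * i + 1) - V (2 * i))"
    if "s \<in> ?st i" for s i using polyline_cell[of "2 * i" s V] that by simp
  have uniq: "i = i'" if "2 * real_of_int i \<le> s" "s < 2 * of_int i + 2" "2 * real_of_int i' \<le> s" "s < 2 * of_int i' + 2"
    for i i' s using that by linarith
  have uniq': "i = i'" if "s \<in> ?dn i" "s \<in> ?dn i'" for i i' s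
    using that uniq[of i "s - 1/2" i'] by auto
  have cover: "s \<in> (\<Union>i. ?dn i) \<union> (\<Union>i. ?st i)" for s
  proof -
    define i where "i = \<lfloor>s / 2\<rfloor>"
    have i: "2 * of_int i \<le> s" "s < 2 * of_int i + 2" unfolding i_def by linarith+
    consider "s = 2 * of_int i" | "s \<in> ?st i" | "s \<in> ?dn i" using i by fastforce
    then show ?thesis
    proof cases
      case 1
      then have "s \<in> ?dn (i - 1)" by simp
      then show ?thesis by blast
    qed blast+
  qed
  have st: "is_interval (?st i) \<and> open (?st i) \<and> strict_mono_on (?st i) (fst \<circ> polyline V)" for i
  proof (intro conjI strict_mono_onI)
    fix r s assume "r \<in> ?st i" "s \<in> ?st i" "r < s"
    then show "(fst \<circ> polyline V) r < (fst \<circ> polyline V) s"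
      using rise(1)[of i] on_st[of r i] on_st[of s i] by (simp add: mult_strict_right_mono)
  qed (auto simp: is_interval_oo)
  have dn: "is_interval (?dn i) \<and> closed (?dn i) \<and> (\<exists>x\<in>?dn i. \<exists>y\<in>?dn i. x < y)
      \<and> (fst \<circ> polyline V) constant_on ?dn i \<and> strict_antimono_on (?dn i) (snd \<circ> polyline V)" for i
  proof (intro conjI)
    show "\<exists>x\<in>?dn i. \<exists>y\<in>?dn i. x < y"
      by (rule bexI[of _ "2 * of_int i + 1"], rule bexI[of _ "2 * of_int i + 2"]) auto
    show "(fst \<circ> polyline V) constant_on ?dn i"
      unfolding constant_on_def by (rule exI[of _ "fst (V (2 * i + 1))"]) (simp add: on_dn drop(1))
    show "strict_antimono_on (?dn i) (snd \<circ> polyline V)"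
    proof (rule monotone_onI)
      fix r s assume "r \<in> ?dn i" "s \<in> ?dn i" "r < s"
      then show "(snd \<circ> polyline V) s < (snd \<circ> polyline V) r"
        using drop(2)[of i] on_dn[of r i] on_dn[of s i] by (simp add: mult_strict_right_mono_neg)
    qed
  qed (auto simp: is_interval_cc)
  have 1: "\<exists>\<S>. disjoint \<S> \<and> \<Union>\<S> = (\<Union>i. ?st i) \<and>
        (\<forall>S\<in>\<S>. is_interval S \<and> openin (top_of_set UNIV) S \<and> strict_mono_on S (fst \<circ> polyline V))"
    using st by (intro exI[of _ "range ?st"] conjI disjoint_unit_cells uniq) auto
  have 2: "\<exists>\<S>. disjoint \<S> \<and> \<Union>\<S> = (\<Union>i. ?dn i) \<and>
        (\<forall>S\<in>\<S>. is_interval S \<and> closedin (top_of_set UNIV) S \<and> (\<exists>x\<in>S. \<exists>y\<in>S. x < y) \<and>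
           (fst \<circ> polyline V) constant_on S \<and> strict_antimono_on S (snd \<circ> polyline V))"
    using dn by (intro exI[of _ "range ?dn"] conjI disjoint_unit_cells uniq') auto
  have 3: "\<exists>\<S>. disjoint \<S> \<and> \<Union>\<S> = ({} :: real set) \<and>
        (\<forall>S\<in>\<S>. is_interval S \<and> closedin (top_of_set UNIV) S \<and> (\<exists>x\<in>S. \<exists>y\<in>S. x < y) \<and>
           (fst \<circ> polyline V) constant_on S \<and> strict_mono_on S (snd \<circ> polyline V))"
    by (rule exI[of _ "{}"]) auto
  have 4: "(\<Union>i. ?dn i) \<inter> (\<Union>i. ?st i) = {}" using rise_drop_disjoint by blast
  have 5: "UNIV = {} \<union> (\<Union>i. ?dn i) \<union> (\<Union>i. ?st i)" using cover by blast
  show ?thesis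
    unfolding admissible_profile_def
    by (intro conjI 1 2 3 4 5 inj mono continuous_polyline is_interval_univ) simp_all
qed

text \<open>
  A certificate for a periodic singular solution: the three parametrisations are given by nodes \<open>x0\<close>, \<open>x1\<close>, \<open>x2\<close>,
  the points they visit on the curve by \<open>P0\<close>, \<open>P1\<close>, \<open>P2\<close>, and the values of \<open>F\<close> there by \<open>f\<close>.  Because everything is
  affine between nodes, the delay equations and the sign conditions need checking at nodes only.

  The predicate \<open>rising\<close> singles out the steps during which \<open>\<mu>0\<close> traverses a rise.  At a node between two other steps \<open>F\<close>
  must be negative, because such a node is interior to the set where \<open>\<mu>0\<close> is on a drop; at a node next
  to a rising step \<open>F\<close> vanishes, which is harmless since that node is a boundary point.

  Minimality of the period comes from the lowest level \<open>b\<close>: the curve attains it only at times in \<open>T \<int>\<close>, and the path of the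
  first delayed point does reach it.
\<close>

lemma zigzag_periodic_singular_solution:
  fixes V :: "int \<Rightarrow> real \<times> real" and x0 x1 x2 :: "int \<Rightarrow> real" and rising :: "int \<Rightarrow> bool"
    and P0 P1 P2 :: "int \<Rightarrow> real \<times> real" and f :: "int \<Rightarrow> real" and a1 a2 b c K1 K2 T :: real and M N :: int
  assumes c: "0 < c"
    and rise: "\<And>i. fst (V (2 * i)) < fst (V (2 * i + 1))"
      "\<And>i. c * (snd (V (2 * i + 1)) - snd (V (2 * i))) = fst (V (2 * i + 1)) - fst (V (2 * i))"
    and drop: "\<And>i. fst (V (2 * i + 2)) = fst (V (2 * i + 1))"
      "\<And>i. snd (V (2 * i + 2)) < snd (V (2 * i + 1))"
    and cells: "\<And>k. \<exists>j. {x0 k, x0 (k + 1)} \<subseteq> {of_int j..of_int j + 1}"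
      "\<And>k. \<exists>j. {x1 k, x1 (k + 1)} \<subseteq> {of_int j..of_int j + 1}"
      "\<And>k. \<exists>j. {x2 k, x2 (k + 1)} \<subseteq> {of_int j..of_int j + 1}"
    and P: "\<And>k. polyline V (x0 k) = P0 k" "\<And>k. polyline V (x1 k) = P1 k" "\<And>k. polyline V (x2 k) = P2 k"
    and f: "\<And>k. f k = - snd (P0 k) - K1 * snd (P1 k) - K2 * snd (P2 k)"
    and delay: "\<And>k. fst (P1 k) = fst (P0 k) - a1 - c * snd (P0 k)"
      "\<And>k. fst (P2 k) = fst (P0 k) - a2 - c * snd (P0 k)"
    and rising: "\<And>k. rising k \<Longrightarrow>
      (\<exists>i. x0 k = 2 * of_int i \<and> x0 (k + 1) = 2 * of_int i + 1) \<and> f k = 0 \<and> f (k + 1) = 0"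
    and falling: "\<And>k. \<not> rising k \<Longrightarrow>
      (\<exists>i. 2 * of_int i + 1 \<le> x0 k \<and> x0 k \<le> x0 (k + 1) \<and> x0 (k + 1) \<le> 2 * of_int i + 2)
        \<and> f k \<le> 0 \<and> f (k + 1) \<le> 0 \<and> (f k < 0 \<or> f (k + 1) < 0)"
    and between_falling: "\<And>k. \<not> rising k \<Longrightarrow> \<not> rising (k + 1) \<Longrightarrow> f (k + 1) < 0"
    and period: "0 < N" "0 < T" "\<And>k. V (k + M) = V k + (T, 0)"
      "\<And>k. x1 (k + N) = x1 k + of_int M" "\<And>k. x2 (k + N) = x2 k + of_int M"
    and lowest: "\<And>k. b \<le> snd (V k)" "\<And>k. snd (V k) = b \<Longrightarrow> \<exists>i. fst (V k) = of_int i * T"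
      "x1 k0 = of_int k1" "snd (V k1) = b"
  shows "periodic_singular_solution a1 a2 c K1 K2 UNIV (polyline V) (polyline x0) (polyline x1) (polyline x2) T"
proof -
  note comp = polyline_compose[where x = x0, OF cells(1), of V] polyline_compose[where x = x1, OF cells(2), of V]
    polyline_compose[where x = x2, OF cells(3), of V]
  have cP: "polyline V (polyline x0 s) = polyline P0 s" "polyline V (polyline x1 s) = polyline P1 s"
    "polyline V (polyline x2 s) = polyline P2 s" for s
    using comp by (simp_all add: P)
  let ?F = "\<lambda>s. - snd (polyline P0 s) - K1 * snd (polyline P1 s) - K2 * snd (polyline P2 s)"
  have F: "?F s = polyline f s" for s
    unfolding ext[of f, OF f] by (simp add: snd_polyline polyline_cmult polyline_diff polyline_uminus)
  let ?dn = "\<Union>i::int. {2 * real_of_int i + 1..2 * of_int i + 2}"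
  let ?st = "\<Union>i::int. {2 * real_of_int i<..<2 * of_int i + 1}"
  have x0_step: "x0 k \<le> x0 (k + 1)" for k
    using rising[of k] falling[of k] by (cases "rising k") auto
  have x0_rising: "polyline x0 s \<in> ?st" if "rising \<lfloor>s\<rfloor>" "s \<noteq> of_int \<lfloor>s\<rfloor>" for s
  proof -
    obtain i where i: "x0 \<lfloor>s\<rfloor> = 2 * of_int i" "x0 (\<lfloor>s\<rfloor> + 1) = 2 * of_int i + 1"
      using rising \<open>rising \<lfloor>s\<rfloor>\<close> by blast
    have "0 < frac s" "frac s < 1"
      using that(2) frac_lt_1[of s] by (auto simp: frac_def) linarith
    then have "polyline x0 s \<in> {2 * of_int i<..<2 * of_int i + 1}" by (simp add: polyline_def i)
    then show ?thesis by blast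
  qed
  note st_dn = rise_drop_disjoint
  have zero: "polyline f s = 0" if "polyline x0 s \<in> ?st" for s
  proof -
    have "rising \<lfloor>s\<rfloor>"
    proof (rule ccontr)
      assume "\<not> rising \<lfloor>s\<rfloor>"
      then obtain i where "2 * of_int i + 1 \<le> x0 \<lfloor>s\<rfloor>" "x0 (\<lfloor>s\<rfloor> + 1) \<le> 2 * of_int i + 2"
        using falling by blast
      then have "polyline x0 s \<in> {2 * of_int i + 1..2 * of_int i + 2}"
        using polyline_between[where x = x0, OF x0_step, of s] by auto
      then show False using st_dn that by blast
    qed
    then show ?thesis using rising[of "\<lfloor>s\<rfloor>"] by (simp add: polyline_def)
  qed
  have neg: "polyline f s < 0" if "s \<in> interior {s. polyline x0 s \<in> ?dn}" for s
  proof -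
    obtain e where e: "e > 0" "\<And>r. dist s r < e \<Longrightarrow> polyline x0 r \<in> ?dn"
      using \<open>s \<in> _\<close> unfolding mem_interior by (auto simp: subset_iff)
    have fall: "\<not> rising \<lfloor>r\<rfloor>" if "dist s r < e" "r \<noteq> of_int \<lfloor>r\<rfloor>" for r
      using x0_rising[of r] that e(2) st_dn by blast
    show ?thesis
    proof (cases "s = of_int \<lfloor>s\<rfloor>")
      case True
      then obtain k where k: "s = of_int k" by blast
      define d where "d = min (e / 2) (1 / 2)"
      have d: "0 < d" "d < e" "d < 1" using e(1) by (auto simp: d_def)
      have fl: "\<lfloor>s + d\<rfloor> = k" "\<lfloor>s - d\<rfloor> = k - 1" using d k by (auto simp: floor_eq_iff)
      have "\<not> rising k" "\<not> rising (k - 1)"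
        using fall[of "s + d"] fall[of "s - d"] d k unfolding fl by (auto simp: dist_real_def)
      then show ?thesis using between_falling[of "k - 1"] by (simp add: k)
    next
      case False
      then have "0 < frac s" "frac s < 1" using frac_lt_1[of s] by (auto simp: frac_def) linarith
      moreover have "f \<lfloor>s\<rfloor> \<le> 0 \<and> f (\<lfloor>s\<rfloor> + 1) \<le> 0 \<and> (f \<lfloor>s\<rfloor> < 0 \<or> f (\<lfloor>s\<rfloor> + 1) < 0)"
        using falling[of "\<lfloor>s\<rfloor>"] fall[of s] False e(1) by simp
      moreover have "polyline f s = (1 - frac s) * f \<lfloor>s\<rfloor> + frac s * f (\<lfloor>s\<rfloor> + 1)"
        by (simp add: polyline_def algebra_simps)
      ultimately show ?thesis
        by (smt (verit) mult_nonneg_nonpos mult_pos_neg)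
    qed
  qed
  have closed0: "closed {s. polyline f s = 0}"
    by (intro closed_Collect_eq continuous_polyline continuous_intros)
  have zero': "polyline f s = 0" if "s \<in> closure {s. polyline x0 s \<in> ?st}" for s
    using closure_minimal[OF _ closed0, of "{s. polyline x0 s \<in> ?st}"] zero that by blast
  have delays: "fst (polyline P1 s) = fst (polyline P0 s) - a1 - c * snd (polyline P0 s)"
    "fst (polyline P2 s) = fst (polyline P0 s) - a2 - c * snd (polyline P0 s)" for s
    using polyline_const[of a1 s] polyline_const[of a2 s]
    by (simp_all add: fst_polyline snd_polyline delay polyline_cmult polyline_diff[symmetric])
  have sol: "singular_solution a1 a2 c K1 K2 UNIV UNIV (polyline V) (polyline x0) (polyline x1) (polyline x2)"
    unfolding singular_solution_def Let_def
    by (rule exI[of _ "{}"], rule exI[of _ ?dn], rule exI[of _ ?st])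
       (use zigzag_admissible[OF c rise drop] x0_step zero' neg delays in
         \<open>auto simp: cP F continuous_polyline intro!: mono_onI polyline_mono\<close>)
  have V_shift: "polyline V (s + of_int M) = polyline V s + (T, 0)" for s
    by (rule polyline_shift) (rule period)
  have per: "T \<in> singular_periods (polyline V) (polyline x1) (polyline x2)"
    using period(1,2) unfolding singular_periods_def
    by (auto intro!: exI[of _ "of_int N"] simp: polyline_shift[where x = x1, OF period(4)]
        polyline_shift[where x = x2, OF period(5)] V_shift)
  \<comment> \<open>No edge is horizontal, so the lowest level can be attained at nodes only.\<close>
  have at_lowest: "\<exists>i. fst (polyline V s) = of_int i * T" if "snd (polyline V s) = b" for s
  proof -
    define g where "g = (\<lambda>k. snd (V k) - b)"
    have g: "g k \<ge> 0" for k using lowest(1) by (simp add: g_def)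
    have "polyline g s = 0"
      using that polyline_const[of b s] by (simp add: g_def polyline_diff[symmetric] snd_polyline)
    then have *: "(1 - frac s) * g \<lfloor>s\<rfloor> + frac s * g (\<lfloor>s\<rfloor> + 1) = 0" by (simp add: polyline_def algebra_simps)
    have "(1 - frac s) * g \<lfloor>s\<rfloor> \<ge> 0" "frac s * g (\<lfloor>s\<rfloor> + 1) \<ge> 0" using g frac_lt_1[of s] by auto
    with * have **: "g \<lfloor>s\<rfloor> = 0" "frac s = 0 \<or> g (\<lfloor>s\<rfloor> + 1) = 0"
      using frac_lt_1[of s] by (auto simp: add_nonneg_eq_0_iff)
    show ?thesis
    proof (cases "frac s = 0")
      case True
      then show ?thesis using lowest(2)[of "\<lfloor>s\<rfloor>"] ** by (simp add: polyline_def g_def del: frac_eq_0_iff)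
    next
      case False
      define k where "k = \<lfloor>s\<rfloor> + 1"
      have "snd (V \<lfloor>s\<rfloor>) = snd (V k)" using ** False by (simp add: g_def k_def)
      moreover have "snd (V (2 * i)) \<noteq> snd (V (2 * i + 1))" "snd (V (2 * i + 1)) \<noteq> snd (V (2 * i + 2))" for i
        using rise(1)[of i] rise(2)[of i] drop(2)[of i] by force+
      moreover have "\<exists>i. \<lfloor>s\<rfloor> = 2 * i \<and> k = 2 * i + 1 \<or> \<lfloor>s\<rfloor> = 2 * i + 1 \<and> k = 2 * i + 2"
        unfolding k_def by presburger
      ultimately show ?thesis by metis
    qed
  qed
  have min: "T \<le> T'" if T': "T' \<in> singular_periods (polyline V) (polyline x1) (polyline x2)" for T'
  proof -
    obtain \<eta>T where "T' > 0" and
      eq: "fst (polyline V (polyline x1 (of_int k0 + \<eta>T))) = fst (V k1) + T'"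
        "snd (polyline V (polyline x1 (of_int k0 + \<eta>T))) = snd (V k1)"
      using T' lowest(3) unfolding singular_periods_def
      by clarsimp (metis polyline_of_int)
    obtain i where "fst (V k1) = of_int i * T" using lowest by blast
    moreover obtain i' where "fst (V k1) + T' = of_int i' * T"
      using at_lowest eq lowest(4) by metis
    ultimately have T'_eq: "T' = of_int (i' - i) * T" by (simp add: algebra_simps)
    then have "1 \<le> i' - i" using \<open>T' > 0\<close> \<open>0 < T\<close> by (simp add: zero_less_mult_iff)
    then have "1 * T \<le> of_int (i' - i) * T" using \<open>0 < T\<close> by (intro mult_right_mono) linarith+
    then show ?thesis using T'_eq by simp
  qed
  show ?thesis unfolding periodic_singular_solution_def using sol per min by blast
qed

section \<open>The sawtooth curve\<close>

text \<open>
  A node sequence with \<open>N\<close> nodes per period is listed as one function of the period index for each residue modulo \<open>N\<close>.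
\<close>

definition interleave :: "(int \<Rightarrow> 'a) list \<Rightarrow> int \<Rightarrow> 'a" where
  "interleave fs k = (fs ! nat (k mod int (length fs))) (k div int (length fs))"

lemma interleave_shift:
  assumes "fs \<noteq> []" "\<forall>f\<in>set fs. \<forall>i. f (i + 1) = f i + q" "N = int (length fs)"
  shows "interleave fs (k + N) = interleave fs k + q"
proof -
  have "nat (k mod int (length fs)) < length fs" using assms(1) by (simp add: nat_less_iff)
  then show ?thesis using assms by (simp add: interleave_def)
qed

lemma interleave5_step:
  fixes k :: int
  assumes "\<And>i. P (5 * i) (5 * i + 1)" "\<And>i. P (5 * i + 1) (5 * i + 2)" "\<And>i. P (5 * i + 2) (5 * i + 3)"
    "\<And>i. P (5 * i + 3) (5 * i + 4)" "\<And>i. P (5 * i + 4) (5 * i + 5)"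
  shows "P k (k + 1)"
proof -
  have "\<exists>i. k = 5 * i \<and> k + 1 = 5 * i + 1 \<or> k = 5 * i + 1 \<and> k + 1 = 5 * i + 2 \<or> k = 5 * i + 2 \<and> k + 1 = 5 * i + 3
    \<or> k = 5 * i + 3 \<and> k + 1 = 5 * i + 4 \<or> k = 5 * i + 4 \<and> k + 1 = 5 * i + 5" by presburger
  then show ?thesis using assms by metis
qed

definition sawtooth_nodes :: "real \<Rightarrow> real \<Rightarrow> real \<Rightarrow> int \<Rightarrow> real \<times> real" where
  "sawtooth_nodes T b c = interleave [\<lambda>i. (of_int i * T, b / c), \<lambda>i. ((of_int i + 1) * T, (b + T) / c)]"

lemma sawtooth_nodes_at:
  "sawtooth_nodes T b c (2 * i) = (of_int i * T, b / c)"
  "sawtooth_nodes T b c (2 * i + 1) = ((of_int i + 1) * T, (b + T) / c)"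
  "sawtooth_nodes T b c (2 * i + 2) = ((of_int i + 1) * T, b / c)"
  by (simp_all add: sawtooth_nodes_def interleave_def)

lemma polyline_between_nodes:
  assumes "V j = (t, u)" "V (j + 1) = (t', u')" "s = of_int j + r" "0 \<le> r" "r \<le> 1"
  shows "polyline V s = (t + r * (t' - t), u + r * (u' - u))"
  using polyline_cell[of j s V] assms by simp

lemma sawtooth_rise:
  assumes "0 \<le> r" "r \<le> 1"
  shows "polyline (sawtooth_nodes T b c) (2 * of_int i + r) = ((of_int i + r) * T, (b + r * T) / c)"
  using polyline_between_nodes[where j = "2 * i", OF sawtooth_nodes_at(1,2) _ assms, of "2 * of_int i + r"]
  by (auto simp: diff_divide_distrib add_divide_distrib algebra_simps)

lemma sawtooth_drop:
  assumes "0 \<le> r" "r \<le> 1"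
  shows "polyline (sawtooth_nodes T b c) (2 * of_int i + 1 + r) = ((of_int i + 1) * T, (b + (1 - r) * T) / c)"
proof -
  have "sawtooth_nodes T b c (2 * i + 1 + 1) = ((of_int i + 1) * T, b / c)"
    using sawtooth_nodes_at(3)[of T b c i] by (simp add: add.assoc)
  from polyline_between_nodes[where j = "2 * i + 1", OF sawtooth_nodes_at(2) this _ assms]
  show ?thesis by (auto simp: diff_divide_distrib add_divide_distrib algebra_simps)
qed

text \<open>
  The five nodes per period are: the foot of a rise; its top; the moment during the drop when the second
  delayed point arrives at the top of a drop; the moment when it has descended that drop, with \<open>\<mu>0\<close> at rest; and
  the end of the drop of \<open>\<mu>0\<close>.  In the fifth step \<open>\<mu>0\<close> rests while the first delayed point slides from the top
  of a drop to height \<open>T / K1\<close> above the bottom; it slides down the remainder while \<open>\<mu>0\<close> climbs the next rise, which keeps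
  \<open>F = 0\<close>.  This needs \<open>K1 > 1\<close>.  The equation \<open>balance\<close> is \<open>F = 0\<close> at the top of a rise, and
  \<open>\<theta> > K2 / (K1 + K2 - 1)\<close> is \<open>F < 0\<close> at the fourth node, when the second delayed point has just descended its drop.
\<close>

lemma sawtooth_solution:
  fixes a1 a2 b c K1 K2 T \<theta> :: real and m n :: nat
  assumes c: "0 < c" and T: "0 < T" and K1: "1 < K1" and K2: "0 < K2"
    and \<theta>: "K2 / (K1 + K2 - 1) < \<theta>" "\<theta> < 1"
    and b: "b = - a1 + real n * T" and a2: "a2 - a1 = (real m + \<theta>) * T"
    and balance: "(b + T) + K1 * b + K2 * (b + (1 - \<theta>) * T) = 0"
  shows "\<exists>\<mu>0 \<mu>1 \<mu>2. periodic_singular_solution a1 a2 c K1 K2 UNIV (polyline (sawtooth_nodes T b c)) \<mu>0 \<mu>1 \<mu>2 T"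
proof -
  let ?V = "sawtooth_nodes T b c"
  have \<theta>0: "0 < \<theta>" using \<theta>(1) K1 K2 by (smt (verit) divide_pos_pos)
  \<comment> \<open>The tooth at which each delayed point is found while \<open>\<mu>0\<close> is on tooth \<open>i\<close>.\<close>
  define j1 where "j1 = (\<lambda>i. i - int n)"
  define j2 where "j2 = (\<lambda>i. i - int n - int m)"
  \<comment> \<open>Positions are written as (integer cell) + (fraction in the unit interval), the form in which the curve is evaluated.\<close>
  define x0 where "x0 = interleave [\<lambda>i. 2 * of_int i + 0, \<lambda>i. 2 * of_int i + 1, \<lambda>i. 2 * of_int i + 1 + \<theta>,
    \<lambda>i. 2 * of_int i + 1 + \<theta>, \<lambda>i. 2 * real_of_int i + 1 + 1]"
  define x1 where "x1 = interleave [\<lambda>i. 2 * of_int (j1 i - 1) + 1 + (1 - 1 / K1), \<lambda>i. 2 * of_int (j1 i) + 0,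
    \<lambda>i. 2 * of_int (j1 i) + \<theta>, \<lambda>i. 2 * of_int (j1 i) + \<theta>, \<lambda>i. 2 * real_of_int (j1 i) + 1]"
  define x2 where "x2 = interleave [\<lambda>i. 2 * of_int (j2 i - 1) + (1 - \<theta>), \<lambda>i. 2 * of_int (j2 i - 1) + (1 - \<theta>),
    \<lambda>i. 2 * of_int (j2 i - 1) + 1, \<lambda>i. 2 * of_int (j2 i) + 0, \<lambda>i. 2 * real_of_int (j2 i) + (1 - \<theta>)]"
  have x0: "x0 (5 * i) = 2 * of_int i + 0" "x0 (5 * i + 1) = 2 * of_int i + 1"
    "x0 (5 * i + 2) = 2 * of_int i + 1 + \<theta>" "x0 (5 * i + 3) = 2 * of_int i + 1 + \<theta>"
    "x0 (5 * i + 4) = 2 * of_int i + 1 + 1" "x0 (5 * i + 5) = 2 * of_int i + 1 + 1" for i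
    by (simp_all add: x0_def interleave_def)
  have x1: "x1 (5 * i) = 2 * of_int (j1 i - 1) + 1 + (1 - 1 / K1)" "x1 (5 * i + 1) = 2 * of_int (j1 i) + 0"
    "x1 (5 * i + 2) = 2 * of_int (j1 i) + \<theta>" "x1 (5 * i + 3) = 2 * of_int (j1 i) + \<theta>"
    "x1 (5 * i + 4) = 2 * of_int (j1 i) + 1" "x1 (5 * i + 5) = 2 * of_int (j1 i) + 1 + (1 - 1 / K1)" for i
    by (simp_all add: x1_def interleave_def j1_def)
  have x2: "x2 (5 * i) = 2 * of_int (j2 i - 1) + (1 - \<theta>)" "x2 (5 * i + 1) = 2 * of_int (j2 i - 1) + (1 - \<theta>)"
    "x2 (5 * i + 2) = 2 * of_int (j2 i - 1) + 1" "x2 (5 * i + 3) = 2 * of_int (j2 i) + 0"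
    "x2 (5 * i + 4) = 2 * of_int (j2 i) + (1 - \<theta>)" "x2 (5 * i + 5) = 2 * of_int (j2 i) + (1 - \<theta>)" for i
    by (simp_all add: x2_def interleave_def j2_def)
  define P where "P x k = polyline ?V (x k)" for x :: "int \<Rightarrow> real" and k
  note rise = sawtooth_rise[of _ T b c] and drop = sawtooth_drop[of _ T b c]
  have rise1: "polyline ?V (2 * of_int i + 1) = ((of_int i + 1) * T, (b + T) / c)" for i
    using rise[of 1 i] by simp
  have drop1: "polyline ?V (2 * of_int i + 1 + (1 - 1 / K1)) = ((of_int i + 1) * T, (b + T / K1) / c)" for i
    using drop[of "1 - 1 / K1" i] K1 by simp
  have rise2: "polyline ?V (2 * of_int i + (1 - \<theta>)) = ((of_int i + 1 - \<theta>) * T, (b + (1 - \<theta>) * T) / c)" for i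
    using rise[of "1 - \<theta>" i] \<theta>0 \<theta>(2) by (simp add: add_diff_eq)
  have P0: "P x0 (5 * i) = (of_int i * T, b / c)" "P x0 (5 * i + 1) = ((of_int i + 1) * T, (b + T) / c)"
    "P x0 (5 * i + 2) = ((of_int i + 1) * T, (b + (1 - \<theta>) * T) / c)"
    "P x0 (5 * i + 3) = ((of_int i + 1) * T, (b + (1 - \<theta>) * T) / c)"
    "P x0 (5 * i + 4) = ((of_int i + 1) * T, b / c)" "P x0 (5 * i + 5) = ((of_int i + 1) * T, b / c)" for i
    using \<theta>0 \<theta>(2) unfolding P_def x0 by (simp_all only: rise rise1 drop order_refl zero_le_one less_imp_le) simp_all
  have P1: "P x1 (5 * i) = (of_int (j1 i) * T, (b + T / K1) / c)" "P x1 (5 * i + 1) = (of_int (j1 i) * T, b / c)"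
    "P x1 (5 * i + 2) = ((of_int (j1 i) + \<theta>) * T, (b + \<theta> * T) / c)"
    "P x1 (5 * i + 3) = ((of_int (j1 i) + \<theta>) * T, (b + \<theta> * T) / c)"
    "P x1 (5 * i + 4) = ((of_int (j1 i) + 1) * T, (b + T) / c)"
    "P x1 (5 * i + 5) = ((of_int (j1 i) + 1) * T, (b + T / K1) / c)" for i
    using \<theta>0 \<theta>(2) unfolding P_def x1
    by (simp_all only: rise rise1 drop1 order_refl zero_le_one less_imp_le) simp_all
  have P2: "P x2 (5 * i) = ((of_int (j2 i) - \<theta>) * T, (b + (1 - \<theta>) * T) / c)"
    "P x2 (5 * i + 1) = ((of_int (j2 i) - \<theta>) * T, (b + (1 - \<theta>) * T) / c)"
    "P x2 (5 * i + 2) = (of_int (j2 i) * T, (b + T) / c)" "P x2 (5 * i + 3) = (of_int (j2 i) * T, b / c)"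
    "P x2 (5 * i + 4) = ((of_int (j2 i) + 1 - \<theta>) * T, (b + (1 - \<theta>) * T) / c)"
    "P x2 (5 * i + 5) = ((of_int (j2 i) + 1 - \<theta>) * T, (b + (1 - \<theta>) * T) / c)" for i
    unfolding P_def x2
    by (simp_all only: rise rise1 rise2 order_refl zero_le_one less_imp_le) simp_all
  \<comment> \<open>The list \<open>js\<close> names, for each step, the edge of the curve on which the point moves.\<close>
  have cells: "\<exists>j. {x k, x (k + 1)} \<subseteq> {of_int j..of_int j + 1}"
    if "\<And>k. {x k, x (k + 1)} \<subseteq> {of_int (interleave js k)..of_int (interleave js k) + 1}"
    for x :: "int \<Rightarrow> real" and js k using that by blast
  have cells0: "\<exists>j. {x0 k, x0 (k + 1)} \<subseteq> {of_int j..of_int j + 1}" for k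
    by (rule cells[of _ "[\<lambda>i. 2 * i, \<lambda>i. 2 * i + 1, \<lambda>i. 2 * i + 1, \<lambda>i. 2 * i + 1, \<lambda>i. 2 * i + 1]"],
        rule interleave5_step) (use \<theta>0 \<theta>(2) in \<open>simp_all add: x0 interleave_def\<close>)
  have cells1: "\<exists>j. {x1 k, x1 (k + 1)} \<subseteq> {of_int j..of_int j + 1}" for k
    by (rule cells[of _ "[\<lambda>i. 2 * j1 i - 1, \<lambda>i. 2 * j1 i, \<lambda>i. 2 * j1 i, \<lambda>i. 2 * j1 i, \<lambda>i. 2 * j1 i + 1]"],
        rule interleave5_step) (use \<theta>0 \<theta>(2) K1 in \<open>simp_all add: x1 interleave_def\<close>)
  have cells2: "\<exists>j. {x2 k, x2 (k + 1)} \<subseteq> {of_int j..of_int j + 1}" for k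
    by (rule cells[of _ "[\<lambda>i. 2 * j2 i - 2, \<lambda>i. 2 * j2 i - 2, \<lambda>i. 2 * j2 i - 1, \<lambda>i. 2 * j2 i, \<lambda>i. 2 * j2 i]"],
        rule interleave5_step) (use \<theta>0 \<theta>(2) in \<open>simp_all add: x2 interleave_def\<close>)
  have delay1: "fst (P x1 k) = fst (P x0 k) - a1 - c * snd (P x0 k)" for k
    by (rule interleave5_step[where P = "\<lambda>k _. fst (P x1 k) = fst (P x0 k) - a1 - c * snd (P x0 k)"])
       (use c in \<open>simp_all add: P0 P1\<close>, simp_all add: b j1_def algebra_simps)
  have "fst (P x2 k) = fst (P x1 k) - (a2 - a1)" for k
    by (rule interleave5_step[where P = "\<lambda>k _. fst (P x2 k) = fst (P x1 k) - (a2 - a1)"])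
       (simp_all add: P1 P2, simp_all add: a2 j1_def j2_def algebra_simps)
  then have delay2: "fst (P x2 k) = fst (P x0 k) - a2 - c * snd (P x0 k)" for k by (simp add: delay1)
  define g where "g k = - (c * snd (P x0 k)) - K1 * (c * snd (P x1 k)) - K2 * (c * snd (P x2 k))" for k
  define f where "f k = - snd (P x0 k) - K1 * snd (P x1 k) - K2 * snd (P x2 k)" for k
  have g: "g k = c * f k" for k by (simp add: g_def f_def algebra_simps)
  have g_at: "g (5 * i) = 0" "g (5 * i + 1) = 0" "g (5 * i + 2) = - (K1 + K2 - 1) * \<theta> * T"
    "g (5 * i + 3) = (K2 - (K1 + K2 - 1) * \<theta>) * T" "g (5 * i + 4) = - (K1 - 1) * T" "g (5 * i + 5) = 0" for i
    using balance c K1 by (simp_all add: g_def P0 P1 P2) (simp_all add: algebra_simps)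
  have \<theta>': "K2 < (K1 + K2 - 1) * \<theta>" using \<theta>(1) K1 K2 by (simp add: field_simps)
  have f_at: "f (5 * i) = 0" "f (5 * i + 1) = 0" "f (5 * i + 2) < 0" "f (5 * i + 3) < 0" "f (5 * i + 4) < 0"
    "f (5 * i + 5) = 0" for i
  proof -
    have sgn: "f k = 0 \<longleftrightarrow> g k = 0" "f k < 0 \<longleftrightarrow> g k < 0" for k
      using c by (auto simp: g mult_less_0_iff)
    show "f (5 * i) = 0" "f (5 * i + 1) = 0" "f (5 * i + 2) < 0" "f (5 * i + 3) < 0" "f (5 * i + 4) < 0"
      "f (5 * i + 5) = 0"
      unfolding sgn g_at using T K1 K2 \<theta>0 \<theta>' by (simp_all add: mult_neg_pos)
  qed
  define rising where "rising k \<longleftrightarrow> k mod 5 = 0" for k :: int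
  have rising_at: "rising (5 * i)" "\<not> rising (5 * i + 1)" "\<not> rising (5 * i + 2)" "\<not> rising (5 * i + 3)"
    "\<not> rising (5 * i + 4)" "rising (5 * i + 5)" for i by (simp_all add: rising_def)
  have "periodic_singular_solution a1 a2 c K1 K2 UNIV (polyline ?V) (polyline x0) (polyline x1) (polyline x2) T"
  proof (rule zigzag_periodic_singular_solution[where rising = rising and b = "b / c" and M = 2 and N = 5
        and ?k0.0 = 1 and ?k1.0 = "2 * j1 0" and ?P0.0 = "P x0" and ?P1.0 = "P x1" and ?P2.0 = "P x2" and f = f])
    have up: "rising k \<longrightarrow> (\<exists>i. x0 k = 2 * of_int i \<and> x0 (k + 1) = 2 * of_int i + 1) \<and> f k = 0 \<and> f (k + 1) = 0"
      for k by (rule interleave5_step[where k = k]) (simp_all add: rising_at x0 f_at)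
    show "rising k \<Longrightarrow> (\<exists>i. x0 k = 2 * of_int i \<and> x0 (k + 1) = 2 * of_int i + 1) \<and> f k = 0 \<and> f (k + 1) = 0"
      for k using up by blast
    have down: "\<not> rising k \<longrightarrow>
      (2 * of_int (k div 5) + 1 \<le> x0 k \<and> x0 k \<le> x0 (k + 1) \<and> x0 (k + 1) \<le> 2 * of_int (k div 5) + 2)
        \<and> f k \<le> 0 \<and> f (k + 1) \<le> 0 \<and> (f k < 0 \<or> f (k + 1) < 0)" for k
      by (rule interleave5_step[where k = k]) (use \<theta>0 \<theta>(2) in \<open>simp_all add: rising_at x0 f_at less_imp_le\<close>)
    show "\<not> rising k \<Longrightarrow>
      (\<exists>i. 2 * of_int i + 1 \<le> x0 k \<and> x0 k \<le> x0 (k + 1) \<and> x0 (k + 1) \<le> 2 * of_int i + 2)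
        \<and> f k \<le> 0 \<and> f (k + 1) \<le> 0 \<and> (f k < 0 \<or> f (k + 1) < 0)" for k
      using down[of k] by blast
    have "\<not> rising k \<longrightarrow> \<not> rising (k + 1) \<longrightarrow> f (k + 1) < 0" for k
      by (rule interleave5_step[where k = k]) (simp_all add: rising_at f_at)
    then show "\<not> rising k \<Longrightarrow> \<not> rising (k + 1) \<Longrightarrow> f (k + 1) < 0" for k by blast
    show "\<exists>i. fst (?V k) = of_int i * T" if "snd (?V k) = b / c" for k
    proof -
      obtain i where "k = 2 * i \<or> k = 2 * i + 1" by atomize_elim presburger
      then show ?thesis using that c T by (auto simp: sawtooth_nodes_at)
    qed
    show "b / c \<le> snd (?V k)" for k
    proof -
      obtain i where "k = 2 * i \<or> k = 2 * i + 1" by atomize_elim presburger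
      then show ?thesis using c T by (auto simp: sawtooth_nodes_at divide_right_mono)
    qed
    show "?V (k + 2) = ?V k + (T, 0)" for k
      unfolding sawtooth_nodes_def
      by (rule interleave_shift) (simp_all add: algebra_simps)
    show "x1 (k + 5) = x1 k + of_int 2" "x2 (k + 5) = x2 k + of_int 2" for k
      unfolding x1_def x2_def
      by (rule interleave_shift; simp add: j1_def j2_def)+
    show "c * (snd (?V (2 * i + 1)) - snd (?V (2 * i))) = fst (?V (2 * i + 1)) - fst (?V (2 * i))" for i
      using c by (simp add: sawtooth_nodes_at) (simp add: field_simps)
    show "snd (?V (2 * i + 2)) < snd (?V (2 * i + 1))" for i
      using c T by (simp add: sawtooth_nodes_at divide_strict_right_mono)
    show "x1 1 = of_int (2 * j1 0)" using x1(2)[of 0] by simp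
  qed (use c T cells0 cells1 cells2 delay1 delay2 in \<open>simp_all add: P_def f_def sawtooth_nodes_at\<close>)
  then show ?thesis by blast
qed

lemma uni_profile_sawtooth:
  "uni_profile a1 a2 c K2 n m K1 =
     polyline (sawtooth_nodes (uni_T a1 a2 K2 n m K1) (- a1 + real n * uni_T a1 a2 K2 n m K1) c)"
proof
  fix \<mu> :: real
  define i where "i = \<lfloor>\<mu> / 2\<rfloor>"
  let ?T = "uni_T a1 a2 K2 n m K1"
  have i: "2 * of_int i \<le> \<mu>" "\<mu> \<le> 2 * of_int i + 2" unfolding i_def by linarith+
  show "uni_profile a1 a2 c K2 n m K1 \<mu> = polyline (sawtooth_nodes ?T (- a1 + real n * ?T) c) \<mu>"
  proof (cases "\<mu> \<le> 2 * of_int i + 1")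
    case True
    then show ?thesis using sawtooth_rise[of "\<mu> - 2 * of_int i" ?T "- a1 + real n * ?T" c i] i
      by (simp add: uni_profile_def Let_def i_def[symmetric]) (simp add: algebra_simps)
  next
    case False
    then show ?thesis using sawtooth_drop[of "\<mu> - (2 * of_int i + 1)" ?T "- a1 + real n * ?T" c i] i
      by (simp add: uni_profile_def Let_def i_def[symmetric]) (simp add: algebra_simps)
  qed
qed

text \<open>
  The formula for \<open>T\<close> is the equation \<open>F = 0\<close> at the top of a rise, solved for \<open>T\<close>.
\<close>

lemma unimodal_solutionI:
  assumes "0 < a1" "a1 < a2" "0 < c" "0 < K2" "1 < K1"
    and \<theta>: "K2 / (K1 + K2 - 1) < uni_theta a1 a2 K2 n m K1" "uni_theta a1 a2 K2 n m K1 < 1"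
  shows "unimodal_solution a1 a2 c K2 n m K1"
proof -
  let ?T = "uni_T a1 a2 K2 n m K1"
  let ?\<theta> = "uni_theta a1 a2 K2 n m K1"
  have D: "0 < 1 + (real m + 1) * K2 + real n * (1 + K1 + K2)"
    using assms by (intro add_pos_nonneg) auto
  have T: "0 < ?T" unfolding uni_T_def using assms by (intro divide_pos_pos D add_pos_pos[of "a1 * _"] mult_pos_pos) auto
  have \<theta>T: "?\<theta> * ?T = a2 - a1 - real m * ?T" using T by (simp add: uni_theta_def field_simps)
  have "?T * (1 + (real m + 1) * K2 + real n * (1 + K1 + K2)) = a1 * (1 + K1 + K2) + (a2 - a1) * K2"
    using D by (simp add: uni_T_def)
  then have "(- a1 + real n * ?T + ?T) + K1 * (- a1 + real n * ?T)
      + K2 * (- a1 + real n * ?T + (1 - ?\<theta>) * ?T) = 0"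
    using \<theta>T by algebra
  moreover have "a2 - a1 = (real m + ?\<theta>) * ?T" using \<theta>T by (simp add: distrib_right)
  ultimately show ?thesis
    using sawtooth_solution[OF assms(3) T assms(5,4) \<theta> refl] assms
    unfolding unimodal_solution_def uni_profile_sawtooth by blast
qed

section \<open>The curve with two teeth per period\<close>

lemma interleave10_step:
  fixes k :: int
  assumes "\<And>i. P (10 * i) (10 * i + 1)" "\<And>i. P (10 * i + 1) (10 * i + 2)" "\<And>i. P (10 * i + 2) (10 * i + 3)"
    "\<And>i. P (10 * i + 3) (10 * i + 4)" "\<And>i. P (10 * i + 4) (10 * i + 5)" "\<And>i. P (10 * i + 5) (10 * i + 6)"
    "\<And>i. P (10 * i + 6) (10 * i + 7)" "\<And>i. P (10 * i + 7) (10 * i + 8)" "\<And>i. P (10 * i + 8) (10 * i + 9)"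
    "\<And>i. P (10 * i + 9) (10 * i + 10)"
  shows "P k (k + 1)"
proof -
  define i where "i = k div 10"
  have "k = 10 * i \<and> k + 1 = 10 * i + 1 \<or> k = 10 * i + 1 \<and> k + 1 = 10 * i + 2 \<or> k = 10 * i + 2 \<and> k + 1 = 10 * i + 3
    \<or> k = 10 * i + 3 \<and> k + 1 = 10 * i + 4 \<or> k = 10 * i + 4 \<and> k + 1 = 10 * i + 5 \<or> k = 10 * i + 5 \<and> k + 1 = 10 * i + 6
    \<or> k = 10 * i + 6 \<and> k + 1 = 10 * i + 7 \<or> k = 10 * i + 7 \<and> k + 1 = 10 * i + 8 \<or> k = 10 * i + 8 \<and> k + 1 = 10 * i + 9
    \<or> k = 10 * i + 9 \<and> k + 1 = 10 * i + 10" unfolding i_def by presburger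
  then show ?thesis using assms[of i] by metis
qed

text \<open>
  The rises have lengths \<open>T1\<close> and \<open>T2\<close>, and \<open>\<sigma>\<close> is the (\<open>c\<close>-scaled) height of the first drop; for the bimodal
  profile \<open>\<sigma> = \<theta> T\<^sub>2\<close>.
\<close>

definition two_tooth_nodes :: "real \<Rightarrow> real \<Rightarrow> real \<Rightarrow> real \<Rightarrow> real \<Rightarrow> int \<Rightarrow> real \<times> real" where
  "two_tooth_nodes T1 T2 \<sigma> b c = interleave
     [\<lambda>i. (of_int i * (T1 + T2), b / c), \<lambda>i. (of_int i * (T1 + T2) + T1, (b + T1) / c),
      \<lambda>i. (of_int i * (T1 + T2) + T1, (b + T1 - \<sigma>) / c), \<lambda>i. ((of_int i + 1) * (T1 + T2), (b + T1 + T2 - \<sigma>) / c)]"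

lemma two_tooth_nodes_at:
  "two_tooth_nodes T1 T2 \<sigma> b c (4 * i) = (of_int i * (T1 + T2), b / c)"
  "two_tooth_nodes T1 T2 \<sigma> b c (4 * i + 1) = (of_int i * (T1 + T2) + T1, (b + T1) / c)"
  "two_tooth_nodes T1 T2 \<sigma> b c (4 * i + 2) = (of_int i * (T1 + T2) + T1, (b + T1 - \<sigma>) / c)"
  "two_tooth_nodes T1 T2 \<sigma> b c (4 * i + 3) = ((of_int i + 1) * (T1 + T2), (b + T1 + T2 - \<sigma>) / c)"
  "two_tooth_nodes T1 T2 \<sigma> b c (4 * i + 4) = ((of_int i + 1) * (T1 + T2), b / c)"
  by (simp_all add: two_tooth_nodes_def interleave_def)

lemma two_tooth_at:
  assumes r: "0 \<le> r" "r \<le> 1"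
  shows two_tooth_rise1: "polyline (two_tooth_nodes T1 T2 \<sigma> b c) (4 * of_int i + r)
      = (of_int i * (T1 + T2) + r * T1, (b + r * T1) / c)"
    and two_tooth_drop1: "polyline (two_tooth_nodes T1 T2 \<sigma> b c) (4 * of_int i + 1 + r)
      = (of_int i * (T1 + T2) + T1, (b + T1 - r * \<sigma>) / c)"
    and two_tooth_rise2: "polyline (two_tooth_nodes T1 T2 \<sigma> b c) (4 * of_int i + 2 + r)
      = (of_int i * (T1 + T2) + T1 + r * T2, (b + T1 - \<sigma> + r * T2) / c)"
    and two_tooth_drop2: "polyline (two_tooth_nodes T1 T2 \<sigma> b c) (4 * of_int i + 3 + r)
      = ((of_int i + 1) * (T1 + T2), (b + (1 - r) * (T1 + T2 - \<sigma>)) / c)"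
proof -
  let ?V = "two_tooth_nodes T1 T2 \<sigma> b c"
  note at = two_tooth_nodes_at[of T1 T2 \<sigma> b c i]
  have at': "?V (4 * i + 1 + 1) = (of_int i * (T1 + T2) + T1, (b + T1 - \<sigma>) / c)"
    "?V (4 * i + 2 + 1) = ((of_int i + 1) * (T1 + T2), (b + T1 + T2 - \<sigma>) / c)"
    "?V (4 * i + 3 + 1) = ((of_int i + 1) * (T1 + T2), b / c)" using at by (simp_all add: add.assoc)
  show "polyline ?V (4 * of_int i + r) = (of_int i * (T1 + T2) + r * T1, (b + r * T1) / c)"
    using polyline_between_nodes[where V = ?V and j = "4 * i", OF at(1,2) _ r, of "4 * of_int i + r"]
    by (simp add: diff_divide_distrib add_divide_distrib)
  show "polyline ?V (4 * of_int i + 1 + r) = (of_int i * (T1 + T2) + T1, (b + T1 - r * \<sigma>) / c)"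
    using polyline_between_nodes[where V = ?V and j = "4 * i + 1", OF at(2) at'(1) _ r, of "4 * of_int i + 1 + r"]
    by (simp add: diff_divide_distrib add_divide_distrib)
  show "polyline ?V (4 * of_int i + 2 + r) = (of_int i * (T1 + T2) + T1 + r * T2, (b + T1 - \<sigma> + r * T2) / c)"
    using polyline_between_nodes[where V = ?V and j = "4 * i + 2", OF at(3) at'(2) _ r, of "4 * of_int i + 2 + r"]
    by (simp add: diff_divide_distrib add_divide_distrib algebra_simps)
  show "polyline ?V (4 * of_int i + 3 + r) = ((of_int i + 1) * (T1 + T2), (b + (1 - r) * (T1 + T2 - \<sigma>)) / c)"
    using polyline_between_nodes[where V = ?V and j = "4 * i + 3", OF at(4) at'(3) _ r, of "4 * of_int i + 3 + r"]
    by (simp add: diff_divide_distrib add_divide_distrib algebra_simps)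
qed

text \<open>
  The ten nodes per period, in terms of the position of \<open>\<mu>0\<close>:
  \<^item> 0, 1: foot and top of the first rise.  Meanwhile the first delayed point slides down the last part of a large drop,
    from height \<open>T1 / K1\<close>.
  \<^item> 2: bottom of the small drop.  In the next step \<open>\<mu>0\<close> rests while the second delayed point slides from the top
    of a large drop to height \<open>T2 / K2\<close>.
  \<^item> 3, 4: foot and top of the second rise.  Meanwhile the second delayed point slides down to the bottom.
  \<^item> 5, 6: \<open>\<mu>0\<close> rests on the large drop while the first delayed point descends the small drop.
  \<^item> 7, 8: likewise for the second delayed point.
  \<^item> 9: bottom of the large drop.  In the last step \<open>\<mu>0\<close> rests while the first delayed point slides from the top of
    a large drop to height \<open>T1 / K1\<close>.

  The equations \<open>balance1\<close> and \<open>balance2\<close> are \<open>F = 0\<close> at the tops of the two rises.  The conditions \<open>fits\<close> say that the heights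
  \<open>T1 / K1\<close> and \<open>T2 / K2\<close> do not exceed the height \<open>T1 + T2 - \<sigma>\<close> of the large drop.  During the descent of the large drop \<open>F\<close> decreases
  except when a delayed point descends the small drop, so its local maxima are at nodes 6 and 8; the conditions
  \<open>steep\<close> say that they are negative.
\<close>

lemma two_tooth_solution:
  fixes a1 a2 b c K1 K2 T1 T2 \<sigma> :: real and m n :: nat
  assumes c: "0 < c" and \<sigma>: "0 < \<sigma>" "\<sigma> < T1" "\<sigma> < T2" and K: "0 < K1" "0 < K2" "1 < K1 + K2"
    and b: "b = - a1 + real n * (T1 + T2)" and a2: "a2 - a1 = real m * (T1 + T2) + \<sigma>"
    and balance1: "(b + T1) + K1 * b + K2 * (b + T1 + T2 - 2 * \<sigma>) = 0"
    and balance2: "(b + T1 + T2 - \<sigma>) + K1 * (b + \<sigma>) + K2 * b = 0"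
    and fits: "T1 < K1 * (T1 + T2 - \<sigma>)" "T2 \<le> K2 * (T1 + T2 - \<sigma>)"
    and steep: "K1 * \<sigma> < (K1 + K2 - 1) * (T1 - \<sigma>)" "(K1 + K2) * \<sigma> < (K1 + K2 - 1) * T1"
  shows "\<exists>\<mu>0 \<mu>1 \<mu>2. periodic_singular_solution a1 a2 c K1 K2 UNIV
           (polyline (two_tooth_nodes T1 T2 \<sigma> b c)) \<mu>0 \<mu>1 \<mu>2 (T1 + T2)"
proof -
  let ?V = "two_tooth_nodes T1 T2 \<sigma> b c"
  \<comment> \<open>\<open>W\<close> is the height of the large drop; the fractions below locate the ten nodes on their edges.\<close>
  define T where "T = T1 + T2"
  define W where "W = T1 + T2 - \<sigma>"
  define r1 where "r1 = \<sigma> / T1"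
  define r2 where "r2 = \<sigma> / T2"
  define w1 where "w1 = T1 / (K1 * W)"
  define w2 where "w2 = T2 / (K2 * W)"
  define d1 where "d1 = (T1 - \<sigma>) / W"
  define d2 where "d2 = T1 / W"
  have pos: "0 < T1" "0 < T2" "0 < T" "0 < W" using \<sigma> by (auto simp: T_def W_def)
  have r: "0 < r1" "r1 < 1" "0 < r2" "r2 < 1" "0 < w1" "w1 < 1" "0 < w2" "w2 \<le> 1" "0 < d1" "d1 < d2" "d2 < 1"
    "0 \<le> d2"
    using \<sigma> K pos fits by (auto simp: r1_def r2_def w1_def w2_def d1_def d2_def divide_strict_right_mono W_def)
  note r' = r(12) r(1,3,5,7,9)[THEN less_imp_le] r(2,4,6,11)[THEN less_imp_le] r(8)
  have scaled: "r1 * T1 = \<sigma>" "r2 * T2 = \<sigma>" "w1 * W = T1 / K1" "w2 * W = T2 / K2" "d1 * W = T1 - \<sigma>" "d2 * W = T1"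
    using \<sigma> pos by (auto simp: r1_def r2_def w1_def w2_def d1_def d2_def)
  define j1 where "j1 = (\<lambda>i. i - int n)"
  define j2 where "j2 = (\<lambda>i. i - int n - int m)"
  define x0 where "x0 = interleave [\<lambda>i. 4 * of_int i + 0, \<lambda>i. 4 * of_int i + 1, \<lambda>i. 4 * of_int i + 2 + 0,
    \<lambda>i. 4 * of_int i + 2 + 0, \<lambda>i. 4 * of_int i + 2 + 1, \<lambda>i. 4 * of_int i + 3 + d1, \<lambda>i. 4 * of_int i + 3 + d1,
    \<lambda>i. 4 * of_int i + 3 + d2, \<lambda>i. 4 * of_int i + 3 + d2, \<lambda>i. 4 * real_of_int i + 3 + 1]"
  define x1 where "x1 = interleave [\<lambda>i. 4 * of_int (j1 i - 1) + 3 + (1 - w1), \<lambda>i. 4 * of_int (j1 i) + 0,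
    \<lambda>i. 4 * of_int (j1 i) + r1, \<lambda>i. 4 * of_int (j1 i) + r1, \<lambda>i. 4 * of_int (j1 i) + r1,
    \<lambda>i. 4 * of_int (j1 i) + 1, \<lambda>i. 4 * of_int (j1 i) + 1 + 1, \<lambda>i. 4 * of_int (j1 i) + 2 + r2,
    \<lambda>i. 4 * of_int (j1 i) + 2 + r2, \<lambda>i. 4 * real_of_int (j1 i) + 2 + 1]"
  define x2 where "x2 = interleave [\<lambda>i. 4 * of_int (j2 i - 1) + 2 + (1 - r2), \<lambda>i. 4 * of_int (j2 i - 1) + 2 + (1 - r2),
    \<lambda>i. 4 * of_int (j2 i - 1) + 2 + 1, \<lambda>i. 4 * of_int (j2 i - 1) + 3 + (1 - w2), \<lambda>i. 4 * of_int (j2 i) + 0,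
    \<lambda>i. 4 * of_int (j2 i) + (1 - r1), \<lambda>i. 4 * of_int (j2 i) + (1 - r1), \<lambda>i. 4 * of_int (j2 i) + 1,
    \<lambda>i. 4 * of_int (j2 i) + 1 + 1, \<lambda>i. 4 * real_of_int (j2 i) + 2 + (1 - r2)]"
  have x0: "x0 (10 * i) = 4 * of_int i + 0" "x0 (10 * i + 1) = 4 * of_int i + 1" "x0 (10 * i + 2) = 4 * of_int i + 2 + 0"
    "x0 (10 * i + 3) = 4 * of_int i + 2 + 0" "x0 (10 * i + 4) = 4 * of_int i + 2 + 1"
    "x0 (10 * i + 5) = 4 * of_int i + 3 + d1" "x0 (10 * i + 6) = 4 * of_int i + 3 + d1"
    "x0 (10 * i + 7) = 4 * of_int i + 3 + d2" "x0 (10 * i + 8) = 4 * of_int i + 3 + d2"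
    "x0 (10 * i + 9) = 4 * of_int i + 3 + 1" "x0 (10 * i + 10) = 4 * of_int i + 3 + 1" for i
    by (simp_all add: x0_def interleave_def)
  have x1: "x1 (10 * i) = 4 * of_int (j1 i - 1) + 3 + (1 - w1)" "x1 (10 * i + 1) = 4 * of_int (j1 i) + 0"
    "x1 (10 * i + 2) = 4 * of_int (j1 i) + r1" "x1 (10 * i + 3) = 4 * of_int (j1 i) + r1"
    "x1 (10 * i + 4) = 4 * of_int (j1 i) + r1" "x1 (10 * i + 5) = 4 * of_int (j1 i) + 1"
    "x1 (10 * i + 6) = 4 * of_int (j1 i) + 1 + 1" "x1 (10 * i + 7) = 4 * of_int (j1 i) + 2 + r2"
    "x1 (10 * i + 8) = 4 * of_int (j1 i) + 2 + r2" "x1 (10 * i + 9) = 4 * of_int (j1 i) + 2 + 1"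
    "x1 (10 * i + 10) = 4 * of_int (j1 i) + 3 + (1 - w1)" for i
    by (simp_all add: x1_def interleave_def j1_def)
  have x2: "x2 (10 * i) = 4 * of_int (j2 i - 1) + 2 + (1 - r2)" "x2 (10 * i + 1) = 4 * of_int (j2 i - 1) + 2 + (1 - r2)"
    "x2 (10 * i + 2) = 4 * of_int (j2 i - 1) + 2 + 1" "x2 (10 * i + 3) = 4 * of_int (j2 i - 1) + 3 + (1 - w2)"
    "x2 (10 * i + 4) = 4 * of_int (j2 i) + 0" "x2 (10 * i + 5) = 4 * of_int (j2 i) + (1 - r1)"
    "x2 (10 * i + 6) = 4 * of_int (j2 i) + (1 - r1)" "x2 (10 * i + 7) = 4 * of_int (j2 i) + 1"
    "x2 (10 * i + 8) = 4 * of_int (j2 i) + 1 + 1" "x2 (10 * i + 9) = 4 * of_int (j2 i) + 2 + (1 - r2)"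
    "x2 (10 * i + 10) = 4 * of_int (j2 i) + 2 + (1 - r2)" for i
    by (simp_all add: x2_def interleave_def j2_def)
  define P where "P x k = polyline ?V (x k)" for x :: "int \<Rightarrow> real" and k
  define Fr where "Fr = {0, 1, r1, r2, 1 - r1, 1 - r2, 1 - w1, 1 - w2, d1, d2}"
  have Fr: "0 \<le> q" "q \<le> 1" if "q \<in> Fr" for q using that r' r(10,11) by (auto simp: Fr_def)
  have R1: "polyline ?V (4 * of_int i + q) = (of_int i * T + q * T1, (b + q * T1) / c)"
    and D1: "polyline ?V (4 * of_int i + 1 + q) = (of_int i * T + T1, (b + T1 - q * \<sigma>) / c)"
    and R2: "polyline ?V (4 * of_int i + 2 + q) = (of_int i * T + T1 + q * T2, (b + T1 - \<sigma> + q * T2) / c)"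
    and D2: "polyline ?V (4 * of_int i + 3 + q) = ((of_int i + 1) * T, (b + (1 - q) * W) / c)"
    if "q \<in> Fr" for q i
    using two_tooth_at[OF Fr[OF that], of T1 T2 \<sigma> b c i] unfolding T_def W_def by auto
  have mem: "0 \<in> Fr" "1 \<in> Fr" "r1 \<in> Fr" "r2 \<in> Fr" "1 - r1 \<in> Fr" "1 - r2 \<in> Fr" "1 - w1 \<in> Fr" "1 - w2 \<in> Fr"
    "d1 \<in> Fr" "d2 \<in> Fr" by (auto simp: Fr_def)
  note R1s = mem[THEN R1] and D1s = mem[THEN D1] and R2s = mem[THEN R2] and D2s = mem[THEN D2]
  note prods = left_diff_distrib scaled mult_1_left mult_zero_left
  have P0: "P x0 (10 * i) = (of_int i * T, b / c)" "P x0 (10 * i + 1) = (of_int i * T + T1, (b + T1) / c)"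
    "P x0 (10 * i + 2) = (of_int i * T + T1, (b + T1 - \<sigma>) / c)" "P x0 (10 * i + 3) = (of_int i * T + T1, (b + T1 - \<sigma>) / c)"
    "P x0 (10 * i + 4) = ((of_int i + 1) * T, (b + T1 + T2 - \<sigma>) / c)"
    "P x0 (10 * i + 5) = ((of_int i + 1) * T, (b + T2) / c)" "P x0 (10 * i + 6) = ((of_int i + 1) * T, (b + T2) / c)"
    "P x0 (10 * i + 7) = ((of_int i + 1) * T, (b + T2 - \<sigma>) / c)" "P x0 (10 * i + 8) = ((of_int i + 1) * T, (b + T2 - \<sigma>) / c)"
    "P x0 (10 * i + 9) = ((of_int i + 1) * T, b / c)" "P x0 (10 * i + 10) = ((of_int i + 1) * T, b / c)" for i
    unfolding P_def x0 by (simp_all only: R1s R2s D2s prods) (simp_all add: T_def W_def algebra_simps)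
  have P1: "P x1 (10 * i) = (of_int (j1 i) * T, (b + T1 / K1) / c)" "P x1 (10 * i + 1) = (of_int (j1 i) * T, b / c)"
    "P x1 (10 * i + 2) = (of_int (j1 i) * T + \<sigma>, (b + \<sigma>) / c)" "P x1 (10 * i + 3) = (of_int (j1 i) * T + \<sigma>, (b + \<sigma>) / c)"
    "P x1 (10 * i + 4) = (of_int (j1 i) * T + \<sigma>, (b + \<sigma>) / c)" "P x1 (10 * i + 5) = (of_int (j1 i) * T + T1, (b + T1) / c)"
    "P x1 (10 * i + 6) = (of_int (j1 i) * T + T1, (b + T1 - \<sigma>) / c)"
    "P x1 (10 * i + 7) = (of_int (j1 i) * T + T1 + \<sigma>, (b + T1) / c)"
    "P x1 (10 * i + 8) = (of_int (j1 i) * T + T1 + \<sigma>, (b + T1) / c)"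
    "P x1 (10 * i + 9) = ((of_int (j1 i) + 1) * T, (b + T1 + T2 - \<sigma>) / c)"
    "P x1 (10 * i + 10) = ((of_int (j1 i) + 1) * T, (b + T1 / K1) / c)" for i
    unfolding P_def x1 by (simp_all only: R1s D1s R2s D2s prods) (simp_all add: T_def W_def algebra_simps)
  have P2: "P x2 (10 * i) = (of_int (j2 i) * T - \<sigma>, (b + T1 + T2 - 2 * \<sigma>) / c)"
    "P x2 (10 * i + 1) = (of_int (j2 i) * T - \<sigma>, (b + T1 + T2 - 2 * \<sigma>) / c)"
    "P x2 (10 * i + 2) = (of_int (j2 i) * T, (b + T1 + T2 - \<sigma>) / c)" "P x2 (10 * i + 3) = (of_int (j2 i) * T, (b + T2 / K2) / c)"
    "P x2 (10 * i + 4) = (of_int (j2 i) * T, b / c)" "P x2 (10 * i + 5) = (of_int (j2 i) * T + T1 - \<sigma>, (b + T1 - \<sigma>) / c)"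
    "P x2 (10 * i + 6) = (of_int (j2 i) * T + T1 - \<sigma>, (b + T1 - \<sigma>) / c)"
    "P x2 (10 * i + 7) = (of_int (j2 i) * T + T1, (b + T1) / c)"
    "P x2 (10 * i + 8) = (of_int (j2 i) * T + T1, (b + T1 - \<sigma>) / c)"
    "P x2 (10 * i + 9) = ((of_int (j2 i) + 1) * T - \<sigma>, (b + T1 + T2 - 2 * \<sigma>) / c)"
    "P x2 (10 * i + 10) = ((of_int (j2 i) + 1) * T - \<sigma>, (b + T1 + T2 - 2 * \<sigma>) / c)" for i
    unfolding P_def x2 by (simp_all only: R1s D1s R2s D2s prods) (simp_all add: T_def W_def algebra_simps)
  \<comment> \<open>The list \<open>js\<close> names, for each step, the edge of the curve on which the point moves.\<close>
  have cells: "\<exists>j. {x k, x (k + 1)} \<subseteq> {of_int j..of_int j + 1}"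
    if "\<And>k. {x k, x (k + 1)} \<subseteq> {of_int (interleave js k)..of_int (interleave js k) + 1}"
    for x :: "int \<Rightarrow> real" and js k using that by blast
  have cells0: "\<exists>j. {x0 k, x0 (k + 1)} \<subseteq> {of_int j..of_int j + 1}" for k
    by (rule cells[of _ "[\<lambda>i. 4 * i, \<lambda>i. 4 * i + 1, \<lambda>i. 4 * i + 2, \<lambda>i. 4 * i + 2, \<lambda>i. 4 * i + 3, \<lambda>i. 4 * i + 3,
          \<lambda>i. 4 * i + 3, \<lambda>i. 4 * i + 3, \<lambda>i. 4 * i + 3, \<lambda>i. 4 * i + 3]"],
        rule interleave10_step) (use r r' in \<open>simp_all add: x0 interleave_def\<close>)
  have cells1: "\<exists>j. {x1 k, x1 (k + 1)} \<subseteq> {of_int j..of_int j + 1}" for k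
    by (rule cells[of _ "[\<lambda>i. 4 * j1 i - 1, \<lambda>i. 4 * j1 i, \<lambda>i. 4 * j1 i, \<lambda>i. 4 * j1 i, \<lambda>i. 4 * j1 i,
          \<lambda>i. 4 * j1 i + 1, \<lambda>i. 4 * j1 i + 2, \<lambda>i. 4 * j1 i + 2, \<lambda>i. 4 * j1 i + 2, \<lambda>i. 4 * j1 i + 3]"],
        rule interleave10_step) (use r r' in \<open>simp_all add: x1 interleave_def\<close>)
  have cells2: "\<exists>j. {x2 k, x2 (k + 1)} \<subseteq> {of_int j..of_int j + 1}" for k
    by (rule cells[of _ "[\<lambda>i. 4 * j2 i - 2, \<lambda>i. 4 * j2 i - 2, \<lambda>i. 4 * j2 i - 1, \<lambda>i. 4 * j2 i - 1, \<lambda>i. 4 * j2 i,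
          \<lambda>i. 4 * j2 i, \<lambda>i. 4 * j2 i, \<lambda>i. 4 * j2 i + 1, \<lambda>i. 4 * j2 i + 2, \<lambda>i. 4 * j2 i + 2]"],
        rule interleave10_step) (use r r' in \<open>simp_all add: x2 interleave_def\<close>)
  have delay1: "fst (P x1 k) = fst (P x0 k) - a1 - c * snd (P x0 k)" for k
    by (rule interleave10_step[where P = "\<lambda>k _. fst (P x1 k) = fst (P x0 k) - a1 - c * snd (P x0 k)"])
       (use c in \<open>simp_all add: P0 P1\<close>, simp_all add: b j1_def T_def algebra_simps)
  have "fst (P x2 k) = fst (P x1 k) - (a2 - a1)" for k
    by (rule interleave10_step[where P = "\<lambda>k _. fst (P x2 k) = fst (P x1 k) - (a2 - a1)"])
       (simp_all add: P1 P2, insert a2, simp_all add: j1_def j2_def T_def algebra_simps)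
  then have delay2: "fst (P x2 k) = fst (P x0 k) - a2 - c * snd (P x0 k)" for k by (simp add: delay1)
  define g where "g k = - (c * snd (P x0 k)) - K1 * (c * snd (P x1 k)) - K2 * (c * snd (P x2 k))" for k
  define f where "f k = - snd (P x0 k) - K1 * snd (P x1 k) - K2 * snd (P x2 k)" for k
  have g: "g k = c * f k" for k by (simp add: g_def f_def algebra_simps)
  have g_at: "g (10 * i) = 0" "g (10 * i + 1) = 0" "g (10 * i + 2) = - (K1 + K2 - 1) * \<sigma>"
    "g (10 * i + 3) = 0" "g (10 * i + 4) = 0" "g (10 * i + 5) = - (K1 + K2 - 1) * (T1 - \<sigma>)"
    "g (10 * i + 6) = K1 * \<sigma> - (K1 + K2 - 1) * (T1 - \<sigma>)"
    "g (10 * i + 7) = K1 * \<sigma> - (K1 + K2 - 1) * T1" "g (10 * i + 8) = (K1 + K2) * \<sigma> - (K1 + K2 - 1) * T1"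
    "g (10 * i + 9) = T1 - K1 * (T1 + T2 - \<sigma>)" "g (10 * i + 10) = 0" for i
    using balance1 balance2 c K by (simp_all add: g_def P0 P1 P2) (simp_all add: algebra_simps)
  have steep': "K1 * \<sigma> < (K1 + K2 - 1) * T1" using steep(2) K \<sigma> by (smt (verit) mult_strict_right_mono)
  have f_at: "f (10 * i) = 0" "f (10 * i + 1) = 0" "f (10 * i + 2) < 0" "f (10 * i + 3) = 0" "f (10 * i + 4) = 0"
    "f (10 * i + 5) < 0" "f (10 * i + 6) < 0" "f (10 * i + 7) < 0" "f (10 * i + 8) < 0" "f (10 * i + 9) < 0"
    "f (10 * i + 10) = 0" for i
  proof -
    have sgn: "f k = 0 \<longleftrightarrow> g k = 0" "f k < 0 \<longleftrightarrow> g k < 0" for k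
      using c by (auto simp: g mult_less_0_iff)
    show "f (10 * i) = 0" "f (10 * i + 1) = 0" "f (10 * i + 2) < 0" "f (10 * i + 3) = 0" "f (10 * i + 4) = 0"
      "f (10 * i + 5) < 0" "f (10 * i + 6) < 0" "f (10 * i + 7) < 0" "f (10 * i + 8) < 0" "f (10 * i + 9) < 0"
      "f (10 * i + 10) = 0"
      unfolding sgn g_at using K \<sigma> steep steep' fits by (simp_all add: mult_neg_pos)
  qed
  define rising where "rising k \<longleftrightarrow> k mod 10 \<in> {0, 3}" for k :: int
  have rising_at: "rising (10 * i)" "\<not> rising (10 * i + 1)" "\<not> rising (10 * i + 2)" "rising (10 * i + 3)"
    "\<not> rising (10 * i + 4)" "\<not> rising (10 * i + 5)" "\<not> rising (10 * i + 6)" "\<not> rising (10 * i + 7)"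
    "\<not> rising (10 * i + 8)" "\<not> rising (10 * i + 9)" "rising (10 * i + 10)" for i by (simp_all add: rising_def)
  note V_at = two_tooth_nodes_at[of T1 T2 \<sigma> b c]
  \<comment> \<open>The parity pattern rise/drop has period 2, the curve has period 4: statements about one tooth split in two.\<close>
  have double: "Q (2 * i) (2 * i + 1) (2 * i + 2)"
    if "\<And>i. Q (4 * i) (4 * i + 1) (4 * i + 2)" "\<And>i. Q (4 * i + 2) (4 * i + 3) (4 * i + 4)"
    for Q and i :: int
  proof -
    obtain l where "i = 2 * l \<or> i = 2 * l + 1" by atomize_elim presburger
    then show ?thesis using that(1)[of l] that(2)[of l] by (auto simp: distrib_left add.assoc)
  qed
  have V_rise: "fst (?V (2 * i)) < fst (?V (2 * i + 1)) \<and>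
      c * (snd (?V (2 * i + 1)) - snd (?V (2 * i))) = fst (?V (2 * i + 1)) - fst (?V (2 * i)) \<and>
      fst (?V (2 * i + 2)) = fst (?V (2 * i + 1)) \<and> snd (?V (2 * i + 2)) < snd (?V (2 * i + 1))" for i
    by (rule double; simp only: V_at fst_conv snd_conv; use c \<sigma> pos in \<open>simp add: field_simps T_def\<close>)
  have V_low: "b / c \<le> snd (?V k) \<and> (snd (?V k) = b / c \<longrightarrow> (\<exists>i. fst (?V k) = of_int i * (T1 + T2)))" for k
  proof -
    obtain i where "k = 4 * i \<or> k = 4 * i + 1 \<or> k = 4 * i + 2 \<or> k = 4 * i + 3" by atomize_elim presburger
    then show ?thesis using c \<sigma> pos by (auto simp: V_at divide_right_mono)
  qed
  have "periodic_singular_solution a1 a2 c K1 K2 UNIV (polyline ?V) (polyline x0) (polyline x1) (polyline x2) (T1 + T2)"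
  proof (rule zigzag_periodic_singular_solution[where rising = rising and b = "b / c" and M = 4 and N = 10
        and ?k0.0 = 1 and ?k1.0 = "4 * j1 0" and ?P0.0 = "P x0" and ?P1.0 = "P x1" and ?P2.0 = "P x2" and f = f])
    have up: "rising k \<longrightarrow> (\<exists>i. x0 k = 2 * of_int i \<and> x0 (k + 1) = 2 * of_int i + 1) \<and> f k = 0 \<and> f (k + 1) = 0" for k
    proof -
      have "rising k \<longrightarrow> (x0 k = 2 * of_int (interleave [\<lambda>i. 2 * i, \<lambda>i. 0, \<lambda>i. 0, \<lambda>i. 2 * i + 1, \<lambda>i. 0, \<lambda>i. 0, \<lambda>i. 0, \<lambda>i. 0, \<lambda>i. 0, \<lambda>i. 0] k)
          \<and> x0 (k + 1) = x0 k + 1) \<and> f k = 0 \<and> f (k + 1) = 0"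
        by (rule interleave10_step[where k = k]) (simp_all add: rising_at x0 f_at interleave_def)
      then show ?thesis by auto
    qed
    show "rising k \<Longrightarrow> (\<exists>i. x0 k = 2 * of_int i \<and> x0 (k + 1) = 2 * of_int i + 1) \<and> f k = 0 \<and> f (k + 1) = 0"
      for k using up by blast
    have down: "\<not> rising k \<longrightarrow>
      (let i = interleave [\<lambda>i. 0, \<lambda>i. 2 * i, \<lambda>i. 2 * i, \<lambda>i. 0, \<lambda>i. 2 * i + 1, \<lambda>i. 2 * i + 1, \<lambda>i. 2 * i + 1, \<lambda>i. 2 * i + 1, \<lambda>i. 2 * i + 1, \<lambda>i. 2 * i + 1] k
       in 2 * of_int i + 1 \<le> x0 k \<and> x0 k \<le> x0 (k + 1) \<and> x0 (k + 1) \<le> 2 * of_int i + 2)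
        \<and> f k \<le> 0 \<and> f (k + 1) \<le> 0 \<and> (f k < 0 \<or> f (k + 1) < 0)" for k
      by (rule interleave10_step[where k = k])
         (use r r' in \<open>simp_all add: rising_at x0 f_at less_imp_le interleave_def\<close>)
    show "\<not> rising k \<Longrightarrow>
      (\<exists>i. 2 * of_int i + 1 \<le> x0 k \<and> x0 k \<le> x0 (k + 1) \<and> x0 (k + 1) \<le> 2 * of_int i + 2)
        \<and> f k \<le> 0 \<and> f (k + 1) \<le> 0 \<and> (f k < 0 \<or> f (k + 1) < 0)" for k
      using down[of k] unfolding Let_def by blast
    have "\<not> rising k \<longrightarrow> \<not> rising (k + 1) \<longrightarrow> f (k + 1) < 0" for k
      by (rule interleave10_step[where k = k]) (simp_all add: rising_at f_at)
    then show "\<not> rising k \<Longrightarrow> \<not> rising (k + 1) \<Longrightarrow> f (k + 1) < 0" for k by blast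
    show "?V (k + 4) = ?V k + (T1 + T2, 0)" for k
      unfolding two_tooth_nodes_def by (rule interleave_shift) (simp_all add: algebra_simps)
    show "x1 (k + 10) = x1 k + of_int 4" "x2 (k + 10) = x2 k + of_int 4" for k
      unfolding x1_def x2_def by (rule interleave_shift; simp add: j1_def j2_def)+
    show "x1 1 = of_int (4 * j1 0)" using x1(2)[of 0] by simp
    show "snd (?V (4 * j1 0)) = b / c" by (simp add: V_at)
  qed (use c pos cells0 cells1 cells2 delay1 delay2 V_rise V_low in \<open>simp_all add: P_def f_def T_def\<close>)
  then show ?thesis by blast
qed

lemma bi_profile_two_tooth:
  "bi_profile a1 a2 c K2 n m K1 =
     polyline (two_tooth_nodes (bi_T1 a1 a2 K2 n m K1) (bi_T2 a1 a2 K2 n m K1)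
       (bi_theta a1 a2 K2 n m K1 * bi_T2 a1 a2 K2 n m K1) (- a1 + real n * bi_T a1 a2 K2 n m K1) c)"
proof
  fix \<mu> :: real
  define i where "i = \<lfloor>\<mu> / 4\<rfloor>"
  let ?T = "bi_T a1 a2 K2 n m K1" and ?T1 = "bi_T1 a1 a2 K2 n m K1" and ?T2 = "bi_T2 a1 a2 K2 n m K1"
  let ?\<theta> = "bi_theta a1 a2 K2 n m K1"
  let ?V = "two_tooth_nodes ?T1 ?T2 (?\<theta> * ?T2) (- a1 + real n * ?T) c"
  have i: "4 * of_int i \<le> \<mu>" "\<mu> \<le> 4 * of_int i + 4" unfolding i_def by linarith+
  have T: "?T1 + ?T2 = ?T" by (simp add: bi_T1_def)
  note at = two_tooth_at[where ?T1.0 = ?T1 and ?T2.0 = ?T2 and \<sigma> = "?\<theta> * ?T2" and b = "- a1 + real n * ?T" and c = c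
      and i = i, unfolded T]
  consider "\<mu> \<le> 4 * of_int i + 1" | "4 * of_int i + 1 < \<mu>" "\<mu> \<le> 4 * of_int i + 2"
    | "4 * of_int i + 2 < \<mu>" "\<mu> \<le> 4 * of_int i + 3" | "4 * of_int i + 3 < \<mu>" by linarith
  then show "bi_profile a1 a2 c K2 n m K1 \<mu> = polyline ?V \<mu>"
  proof cases
    case 1
    then show ?thesis using at(1)[of "\<mu> - 4 * of_int i"] i
      by (simp add: bi_profile_def Let_def i_def[symmetric])
  next
    case 2
    then show ?thesis using at(2)[of "\<mu> - (4 * of_int i + 1)"] i
      by (simp add: bi_profile_def Let_def i_def[symmetric]; simp add: algebra_simps)
  next
    case 3
    then show ?thesis using at(3)[of "\<mu> - (4 * of_int i + 2)"] i
      by (simp add: bi_profile_def Let_def i_def[symmetric]; simp add: algebra_simps)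
  next
    case 4
    then show ?thesis using at(4)[of "\<mu> - (4 * of_int i + 3)"] i
      by (simp add: bi_profile_def Let_def i_def[symmetric]; simp add: algebra_simps)
  qed
qed

text \<open>
  The formulas for \<open>T\<close> and \<open>T\<^sub>2\<close> solve the equations \<open>F = 0\<close> at the tops of the two rises.  Subtracting these two equations
  gives \<open>K2 T = T\<^sub>2 + \<theta> T\<^sub>2 (K1 + 2 K2 - 1)\<close>, and this turns \<open>\<theta> < T\<^sub>1 / T\<^sub>2 + 1 - 1 / K2\<close> into
  \<open>K1 + K2 > 1\<close>.  The hypotheses \<open>h1\<close> and \<open>h2\<close> make \<open>F\<close> negative after the second and the first delayed point
  have descended the small drop; \<open>h3\<close> makes the drop of height \<open>T - \<theta> T\<^sub>2\<close> long enough for the slide from height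
  \<open>T\<^sub>1 / K1\<close>, which for \<open>K1 \<ge> 1\<close> is automatic.
\<close>

lemma bimodal2_solutionI:
  fixes a1 a2 c K1 K2 :: real and n m :: nat
  defines "T1 \<equiv> bi_T1 a1 a2 K2 n m K1" and "T2 \<equiv> bi_T2 a1 a2 K2 n m K1" and "\<theta> \<equiv> bi_theta a1 a2 K2 n m K1"
  assumes a: "0 < a1" and c: "0 < c" and K: "0 < K2" "0 < K1" "1 < K1 + K2"
    and D: "1 - real m * (K1 - 1) + real n * (1 + K1 + K2) \<noteq> 0"
    and T2: "0 < T2" and \<theta>: "0 < \<theta>" "\<theta> < 1"
    and h1: "\<theta> < (1 - 1 / (K1 + K2)) * (T1 / T2)"
    and h2: "\<theta> < (1 - K1 / (2 * K1 + K2 - 1)) * (T1 / T2)"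
    and h3: "K1 < 1 \<Longrightarrow> \<theta> < 1 - (1 - K1) / K1 * (T1 / T2)"
  shows "bimodal2_solution a1 a2 c K2 n m K1"
proof -
  define T where "T = bi_T a1 a2 K2 n m K1"
  define \<sigma> where "\<sigma> = \<theta> * T2"
  have T: "T = T1 + T2" by (simp add: T_def T1_def T2_def bi_T1_def)
  have \<sigma>_eq: "\<sigma> = a2 - a1 - real m * T" using T2 by (simp add: \<sigma>_def \<theta>_def T2_def T_def bi_theta_def)
  let ?D = "1 - real m * (K1 - 1) + real n * (1 + K1 + K2)"
  have TD: "T * ?D = a1 * (1 + K1 + K2) + (a2 - a1) * (1 - K1)" using D by (simp add: T_def bi_T_def)
  have T2D: "T2 * ?D = (real m * a1 - real n * (a2 - a1)) * (K1 + K2 + 1) * (K1 + 2 * K2 - 1)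
     - K1 * ((a2 - a1) * (1 + K2) - a1 * K2) + a1 * (K2 * (1 + K2)) + (a2 - a1) * (1 - K2)"
  proof -
    have "T2 * ?D = a1 * H_fun (a2 / a1) K2 n m K1" using D by (simp add: T2_def bi_T2_def)
    also have "\<dots> = (real m * a1 - real n * (a1 * (a2 / a1 - 1))) * (K1 + K2 + 1) * (K1 + 2 * K2 - 1)
     - K1 * (a1 * (a2 / a1 - 1) * (1 + K2) - a1 * K2) + a1 * (K2 * (1 + K2)) + a1 * (a2 / a1 - 1) * (1 - K2)"
      unfolding H_fun_def by algebra
    also have "a1 * (a2 / a1 - 1) = a2 - a1" using a by (simp add: field_simps)
    finally show ?thesis .
  qed
  define b where "b = - a1 + real n * (T1 + T2)"
  have balance2: "(b + T1 + T2 - \<sigma>) + K1 * (b + \<sigma>) + K2 * b = 0"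
    unfolding b_def \<sigma>_eq using TD T by algebra
  have "?D * ((b + T1) + K1 * b + K2 * (b + T1 + T2 - 2 * \<sigma>)) = 0"
    unfolding b_def \<sigma>_eq T[symmetric] using TD T2D T by algebra
  then have balance1: "(b + T1) + K1 * b + K2 * (b + T1 + T2 - 2 * \<sigma>) = 0" using D by simp
  have K2T: "K2 * (T1 + T2) = T2 + \<sigma> * (K1 + 2 * K2 - 1)" using balance1 balance2 by algebra
  have \<sigma>: "0 < \<sigma>" "\<sigma> < T2" using \<theta> T2 by (auto simp: \<sigma>_def)
  have scale: "(q * T2) * ((1 - k / q) * (T1 / T2)) = (q - k) * T1" if "0 < q" for q k :: real
    using that T2 by (simp add: field_simps)
  have s1: "(K1 + K2) * \<sigma> < (K1 + K2 - 1) * T1"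
  proof -
    have "((K1 + K2) * T2) * \<theta> < ((K1 + K2) * T2) * ((1 - 1 / (K1 + K2)) * (T1 / T2))"
      using h1 T2 K by (intro mult_strict_left_mono) auto
    also have "\<dots> = (K1 + K2 - 1) * T1" using K by (subst scale) auto
    finally show ?thesis by (simp add: \<sigma>_def mult_ac)
  qed
  have "(2 * K1 + K2 - 1) * \<sigma> < (K1 + K2 - 1) * T1"
  proof -
    have "((2 * K1 + K2 - 1) * T2) * \<theta> < ((2 * K1 + K2 - 1) * T2) * ((1 - K1 / (2 * K1 + K2 - 1)) * (T1 / T2))"
      using h2 T2 K by (intro mult_strict_left_mono) auto
    also have "\<dots> = (K1 + K2 - 1) * T1" using K by (subst scale) auto
    finally show ?thesis by (simp add: \<sigma>_def mult_ac)
  qed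
  then have s2: "K1 * \<sigma> < (K1 + K2 - 1) * (T1 - \<sigma>)" by (simp add: algebra_simps)
  have "0 < (K1 + K2 - 1) * (T1 - \<sigma>)" using s2 K \<sigma> by (smt (verit) mult_pos_pos)
  then have \<sigma>T1: "\<sigma> < T1" using K by (simp add: zero_less_mult_iff)
  have "\<sigma> * K2 < \<sigma> * (K1 + 2 * K2 - 1)" using K \<sigma> by (intro mult_strict_left_mono) auto
  then have f2: "T2 < K2 * (T1 + T2 - \<sigma>)" using K2T by (simp add: algebra_simps)
  have f1: "T1 < K1 * (T1 + T2 - \<sigma>)"
  proof (cases "K1 < 1")
    case True
    then show ?thesis using h3[OF True] T2 K by (simp add: \<sigma>_def field_simps)
  next
    case False
    have "1 * (T1 + T2 - \<sigma>) \<le> K1 * (T1 + T2 - \<sigma>)" using False \<sigma> \<sigma>T1 by (intro mult_right_mono) auto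
    then show ?thesis using \<sigma> by simp
  qed
  have a2: "a2 - a1 = real m * (T1 + T2) + \<sigma>" using \<sigma>_eq T by simp
  note sol = two_tooth_solution[OF c \<sigma>(1) \<sigma>T1 \<sigma>(2) K(2,1,3) b_def a2 balance1 balance2 f1 less_imp_le[OF f2] s2 s1]
  have third: "\<theta> < T1 / T2 + 1 - 1 / K2" using f2 T2 K by (simp add: \<sigma>_def field_simps)
  show ?thesis
    unfolding bimodal2_solution_def Let_def bi_profile_two_tooth
    using sol K T2 \<theta> h1 h2 h3 third
    by (simp add: T1_def[symmetric] T2_def[symmetric] \<theta>_def[symmetric] T_def[symmetric] T b_def \<sigma>_def)
qed

section \<open>Degeneration of the two-tooth curve\<close>

lemma range_sawtooth:
  "range (polyline (sawtooth_nodes T b c)) =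
     {((of_int i + r) * T, (b + r * T) / c) | i r. 0 \<le> r \<and> r \<le> 1} \<union>
     {((of_int i + 1) * T, (b + (1 - r) * T) / c) | i r. 0 \<le> r \<and> r \<le> 1}" (is "_ = ?up \<union> ?dn")
proof (intro equalityI subsetI)
  fix z assume "z \<in> range (polyline (sawtooth_nodes T b c))"
  then obtain s where s: "z = polyline (sawtooth_nodes T b c) s" by blast
  define i where "i = \<lfloor>s / 2\<rfloor>"
  have i: "2 * of_int i \<le> s" "s \<le> 2 * of_int i + 2" unfolding i_def by linarith+
  show "z \<in> ?up \<union> ?dn"
  proof (cases "s \<le> 2 * of_int i + 1")
    case True
    define r where "r = s - 2 * of_int i"
    have r: "0 \<le> r" "r \<le> 1" using True i by (auto simp: r_def)
    have "z = ((of_int i + r) * T, (b + r * T) / c)" using sawtooth_rise[OF r, of T b c i] s by (simp add: r_def)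
    then show ?thesis using r by blast
  next
    case False
    define r where "r = s - (2 * of_int i + 1)"
    have r: "0 \<le> r" "r \<le> 1" using False i by (auto simp: r_def)
    have "z = ((of_int i + 1) * T, (b + (1 - r) * T) / c)" using sawtooth_drop[OF r, of T b c i] s by (simp add: r_def)
    then show ?thesis using r by blast
  qed
next
  fix z assume "z \<in> ?up \<union> ?dn"
  then show "z \<in> range (polyline (sawtooth_nodes T b c))"
  proof
    assume "z \<in> ?up"
    then obtain i r where "0 \<le> r" "r \<le> 1" "z = ((of_int i + r) * T, (b + r * T) / c)" by blast
    then show ?thesis using sawtooth_rise[of r T b c i] by (metis rangeI)
  next
    assume "z \<in> ?dn"
    then obtain i r where "0 \<le> r" "r \<le> 1" "z = ((of_int i + 1) * T, (b + (1 - r) * T) / c)" by blast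
    then show ?thesis using sawtooth_drop[of r T b c i] by (metis rangeI)
  qed
qed

text \<open>
  When the small drop vanishes, the two rises join into a single one of length \<open>T1 + T2\<close>.  The two parametrisations
  still differ (the degenerate one pauses at the join), so only the traces agree.
\<close>

lemma range_two_tooth_degenerate:
  assumes T: "0 < T1" "0 < T2"
  shows "range (polyline (two_tooth_nodes T1 T2 0 b c)) = range (polyline (sawtooth_nodes (T1 + T2) b c))"
    (is "range (polyline ?V) = _")
proof (intro equalityI subsetI)
  let ?T = "T1 + T2"
  fix z assume "z \<in> range (polyline ?V)"
  then obtain s where s: "z = polyline ?V s" by blast
  define i where "i = \<lfloor>s / 4\<rfloor>"
  have i: "4 * of_int i \<le> s" "s \<le> 4 * of_int i + 4" unfolding i_def by linarith+
  have up: "z \<in> range (polyline (sawtooth_nodes ?T b c))" if "z = (of_int i * ?T + h, (b + h) / c)" "0 \<le> h" "h \<le> ?T" for h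
  proof -
    have "z = ((of_int i + h / ?T) * ?T, (b + h / ?T * ?T) / c)" using that(1) T by (simp add: distrib_right)
    moreover have "0 \<le> h / ?T" "h / ?T \<le> 1" using that T by auto
    ultimately show ?thesis unfolding range_sawtooth by blast
  qed
  consider "s \<le> 4 * of_int i + 1" | "4 * of_int i + 1 < s" "s \<le> 4 * of_int i + 2"
    | "4 * of_int i + 2 < s" "s \<le> 4 * of_int i + 3" | "4 * of_int i + 3 < s" by linarith
  then show "z \<in> range (polyline (sawtooth_nodes ?T b c))"
  proof cases
    case 1
    then show ?thesis using two_tooth_rise1[of "s - 4 * of_int i" T1 T2 0 b c i] i T s
      by (intro up[of "(s - 4 * of_int i) * T1"]) (auto intro: order_trans[OF mult_left_le_one_le])
  next
    case 2
    then show ?thesis using two_tooth_drop1[of "s - (4 * of_int i + 1)" T1 T2 0 b c i] T s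
      by (intro up[of T1]) auto
  next
    case 3
    define r where "r = s - (4 * of_int i + 2)"
    have "r * T2 \<le> T2" using 3 T by (intro mult_left_le_one_le) (auto simp: r_def)
    then show ?thesis using 3 two_tooth_rise2[of r T1 T2 0 b c i] T s
      by (intro up[of "T1 + r * T2"]) (auto simp: r_def add.assoc)
  next
    case 4
    define r where "r = s - (4 * of_int i + 3)"
    have r: "0 \<le> r" "r \<le> 1" using 4 i by (auto simp: r_def)
    have "z = ((of_int i + 1) * ?T, (b + (1 - r) * ?T) / c)"
      using two_tooth_drop2[OF r, of T1 T2 0 b c i] s by (simp add: r_def)
    then show ?thesis unfolding range_sawtooth using r by blast
  qed
next
  let ?T = "T1 + T2"
  fix z assume "z \<in> range (polyline (sawtooth_nodes ?T b c))"
  then consider i r where "0 \<le> r" "r \<le> 1" "z = ((of_int i + r) * ?T, (b + r * ?T) / c)"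
    | i r where "0 \<le> r" "r \<le> 1" "z = ((of_int i + 1) * ?T, (b + (1 - r) * ?T) / c)"
    unfolding range_sawtooth by blast
  then show "z \<in> range (polyline ?V)"
  proof cases
    case (1 i r)
    have z: "z = (of_int i * ?T + r * ?T, (b + r * ?T) / c)" using 1 by (simp add: distrib_right)
    have rT: "0 \<le> r * ?T" "r * ?T \<le> ?T" using 1 T by (auto intro: mult_left_le_one_le)
    show ?thesis
    proof (cases "r * ?T \<le> T1")
      case True
      then have "z = polyline ?V (4 * of_int i + r * ?T / T1)"
        using two_tooth_rise1[of "r * ?T / T1" T1 T2 0 b c i] z rT T by simp
      then show ?thesis by blast
    next
      case False
      then have "z = polyline ?V (4 * of_int i + 2 + (r * ?T - T1) / T2)"
        using two_tooth_rise2[of "(r * ?T - T1) / T2" T1 T2 0 b c i] z rT T by simp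
      then show ?thesis by blast
    qed
  next
    case (2 i r)
    then have "z = polyline ?V (4 * of_int i + 3 + r)" using two_tooth_drop2[of r T1 T2 0 b c i] by simp
    then show ?thesis by blast
  qed
qed

lemma sawtooth_nodes_tendsto:
  assumes "(T \<longlongrightarrow> T0) F" "(b \<longlongrightarrow> b0) F" "c \<noteq> 0"
  shows "((\<lambda>K. sawtooth_nodes (T K) (b K) c k) \<longlongrightarrow> sawtooth_nodes T0 b0 c k) F"
proof -
  obtain i where "k = 2 * i \<or> k = 2 * i + 1" by atomize_elim presburger
  then show ?thesis using assms by (auto simp: sawtooth_nodes_at intro!: tendsto_intros)
qed

lemma two_tooth_nodes_tendsto:
  assumes "(T1 \<longlongrightarrow> T10) F" "(T2 \<longlongrightarrow> T20) F" "(\<sigma> \<longlongrightarrow> \<sigma>0) F" "(b \<longlongrightarrow> b0) F" "c \<noteq> 0"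
  shows "((\<lambda>K. two_tooth_nodes (T1 K) (T2 K) (\<sigma> K) (b K) c k) \<longlongrightarrow> two_tooth_nodes T10 T20 \<sigma>0 b0 c k) F"
proof -
  obtain i where "k = 4 * i \<or> k = 4 * i + 1 \<or> k = 4 * i + 2 \<or> k = 4 * i + 3" by atomize_elim presburger
  then show ?thesis using assms by (auto simp: two_tooth_nodes_at intro!: tendsto_intros)
qed

section \<open>Parameter ranges of unimodal solutions\<close>

text \<open>
  In terms of \<open>x = m + 1 - n d\<close> the index \<open>n\<close> cancels from \<open>\<theta>\<close>.
\<close>

lemma uni_theta_eq:
  fixes a1 a2 K1 K2 :: real and n m :: nat
  defines "d \<equiv> a2 / a1 - 1"
  defines "x \<equiv> real m + 1 - real n * d"
  assumes "0 < a1" "a1 < a2" "0 < K2" "0 < K1"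
  shows "uni_theta a1 a2 K2 n m K1 = 1 - x + d * (1 + x * K2) / (1 + K1 + K2 + d * K2)"
proof -
  have d: "0 < d" "a2 - a1 = a1 * d" using assms by (auto simp: d_def field_simps)
  let ?S = "1 + K1 + K2"
  have pos: "0 < ?S + d * K2" using d assms by (intro add_pos_pos mult_pos_pos) auto
  have "uni_T a1 a2 K2 n m K1 = a1 * (?S + d * K2) / (1 + x * K2 + real n * (?S + d * K2))"
    unfolding uni_T_def d(2) by (simp add: x_def algebra_simps)
  then have "uni_theta a1 a2 K2 n m K1 = a1 * d / (a1 * (?S + d * K2) / (1 + x * K2 + real n * (?S + d * K2))) - real m"
    unfolding uni_theta_def d(2) by simp
  also have "\<dots> = d * (1 + x * K2 + real n * (?S + d * K2)) / (?S + d * K2) - real m"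
    using assms(3) by simp
  also have "\<dots> = d * (1 + x * K2) / (?S + d * K2) + real n * d - real m"
  proof -
    have "d * (y + real n * Q) / Q = d * y / Q + real n * d" if "0 < Q" for y Q
      using that by (simp add: field_simps)
    then show ?thesis using pos by simp
  qed
  finally show ?thesis by (simp add: x_def)
qed

text \<open>
  The condition \<open>\<theta> < 1\<close> amounts to \<open>d < x (1 + K1 + K2)\<close>, that is, to \<open>K1 > L\<close>; the lower bound on \<open>\<theta>\<close>, multiplied by the
  positive denominators, is exactly \<open>G < 0\<close>.
\<close>

lemma unimodal_solution_if_G_negative:
  fixes a1 a2 c K1 K2 :: real and n m :: nat
  assumes a: "0 < a1" "a1 < a2" and c: "0 < c" and K2: "0 < K2"
    and x: "0 < real m + 1 - real n * (a2 / a1 - 1)"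
    and K1: "1 < K1" "L_bound (a2 / a1) K2 n m < K1" "G_fun (a2 / a1) K2 n m K1 < 0"
  shows "unimodal_solution a1 a2 c K2 n m K1"
proof (rule unimodal_solutionI[OF a c K2 K1(1)])
  define d where "d = a2 / a1 - 1"
  define x where "x = real m + 1 - real n * d"
  define S where "S = 1 + K1 + K2"
  have d: "0 < d" using a by (simp add: d_def)
  have x0: "0 < x" using x by (simp add: x_def d_def)
  have pos: "0 < S + d * K2" using d K2 K1 by (auto simp: S_def intro!: add_pos_pos mult_pos_pos)
  have \<theta>: "uni_theta a1 a2 K2 n m K1 = 1 - x + d * (1 + x * K2) / (S + d * K2)"
    using uni_theta_eq[OF a K2, of K1 n m] K1 by (simp add: d_def x_def S_def)
  have "d / x < S" using K1(2) by (simp add: L_bound_def d_def x_def S_def algebra_simps)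
  then have "d < S * x" using x0 by (simp add: field_simps)
  then have "d * (1 + x * K2) < x * (S + d * K2)" by (simp add: algebra_simps)
  then have "d * (1 + x * K2) / (S + d * K2) < x" using pos by (simp add: field_simps)
  then show "uni_theta a1 a2 K2 n m K1 < 1" unfolding \<theta> by simp
  have "K2 * (S + d * K2) < ((1 - x) * (S + d * K2) + d * (1 + x * K2)) * (K1 + K2 - 1)"
  proof -
    have "((1 - x) * (S + d * K2) + d * (1 + x * K2)) * (K1 + K2 - 1) - K2 * (S + d * K2) = - G_fun (a2 / a1) K2 n m K1"
      unfolding G_fun_def S_def x_def d_def by algebra
    then show ?thesis using K1(3) by linarith
  qed
  moreover have "1 - x + d * (1 + x * K2) / (S + d * K2) = ((1 - x) * (S + d * K2) + d * (1 + x * K2)) / (S + d * K2)"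
    using pos by (simp add: add_divide_distrib)
  ultimately show "K2 / (K1 + K2 - 1) < uni_theta a1 a2 K2 n m K1"
    unfolding \<theta> using pos K1(1) K2 by (simp only:) (simp add: divide_simps)
qed

text \<open>
  Expanding \<open>G\<close> with \<open>d = x (1 + L + K2)\<close> separates the contributions of \<open>K1 - L\<close> and \<open>K1 - 1\<close>.  At \<open>K1 = L\<close> it shows \<open>G < 0\<close>
  if \<open>L > 1\<close>; if \<open>L = 1\<close> the two factors agree and \<open>G\<close> has a simple zero there, with negative slope.
\<close>

lemma G_near_L:
  fixes A K1 K2 :: real and n m :: nat
  defines "x \<equiv> real m + 1 - real n * (A - 1)" and "L \<equiv> L_bound A K2 n m"
  assumes "x \<noteq> 0"
  shows "G_fun A K2 n m K1 = (K1 - L) * x * ((K1 - 1) * (1 + K2) + K2) - (1 + K1 + K2) * (1 + x * K2) * (K1 - 1)"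
proof -
  have d: "A - 1 = x * (L + 1 + K2)" using assms(3) by (simp add: L_def L_bound_def x_def field_simps)
  have z: "real m - real n * (A - 1) = x - 1" by (simp add: x_def)
  show ?thesis unfolding G_fun_def z unfolding d by algebra
qed

lemma eventually_G_negative:
  fixes A K2 :: real and n m :: nat
  defines "x \<equiv> real m + 1 - real n * (A - 1)" and "L \<equiv> L_bound A K2 n m"
  assumes K2: "0 < K2" and x: "0 < x" and L: "1 \<le> L"
  shows "\<forall>\<^sub>F K1 in at_right L. G_fun A K2 n m K1 < 0"
proof (cases "L = 1")
  case False
  have lim: "(G_fun A K2 n m \<longlongrightarrow> G_fun A K2 n m L) (at L)"
    unfolding G_fun_def by (intro tendsto_intros)
  have "G_fun A K2 n m L = - ((1 + L + K2) * (1 + x * K2) * (L - 1))"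
    using G_near_L[of m n A K2 L] x unfolding x_def L_def by simp
  moreover have "0 < (1 + L + K2) * (1 + x * K2) * (L - 1)"
    using K2 x L False by (intro mult_pos_pos add_pos_pos) auto
  ultimately have "\<forall>\<^sub>F K1 in at L. G_fun A K2 n m K1 < 0" using order_tendstoD(2)[OF lim] by simp
  then show ?thesis using eventually_at_split by blast
next
  case True
  let ?q = "\<lambda>K1. (1 + K1 + K2) * (1 + x * K2) - x * ((K1 - 1) * (1 + K2) + K2)"
  have lim: "(?q \<longlongrightarrow> ?q L) (at_right L)" by (intro tendsto_intros)
  have "0 < ?q L" using K2 x by (simp add: True algebra_simps add_pos_pos)
  then have "\<forall>\<^sub>F K1 in at_right L. 0 < ?q K1" by (rule order_tendstoD(1)[OF lim])
  moreover have "\<forall>\<^sub>F K1 in at_right L. L < K1" by (simp add: eventually_at_filter)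
  ultimately show ?thesis
  proof eventually_elim
    case (elim K1)
    have "G_fun A K2 n m K1 = - ((K1 - 1) * ?q K1)"
      using G_near_L[of m n A K2 K1] x True unfolding x_def L_def by (simp add: algebra_simps)
    then show ?case using elim True by simp
  qed
qed

text \<open>
  Here \<open>z = x - 1\<close> is the leading coefficient of \<open>G\<close>.  The discriminant \<open>\<Delta>\<close> of \<open>G\<close> as a quadratic in \<open>K1 + K2\<close> is itself a quadratic
  in \<open>z\<close>, and the number \<open>m\<^sup>*\<^sup>*(n) - n d\<close> is its smaller root, whence \<open>\<Delta> > 0\<close>.  The roots lie on the same side of \<open>1\<close>
  because \<open>G(1) > 0\<close>, and their sum exceeds \<open>2\<close> because \<open>2 (z + 1) < d\<close>.
\<close>

lemma G_roots:
  fixes A K2 :: real and n m :: nat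
  defines "d \<equiv> A - 1" and "z \<equiv> real m - real n * (A - 1)"
  assumes K2: "0 < K2" and d: "0 < d" and z: "0 < z" and L: "d < (z + 1) * (2 + K2)"
    and small: "real m < m_star2 A K2 n" and half: "z + 1 < d / 2"
  shows "{K1. G_fun A K2 n m K1 = 0} = {M_minus A K2 n m, M_plus A K2 n m} \<and> 1 < M_minus A K2 n m \<and>
     M_minus A K2 n m < M_plus A K2 n m \<and>
     (\<forall>K1. M_minus A K2 n m < K1 \<and> K1 < M_plus A K2 n m \<longrightarrow> G_fun A K2 n m K1 < 0)"
proof -
  define E where "E = d * (1 + K2) - K2"
  define C where "C = d * ((1 + K2)\<^sup>2 - K2) + K2"
  define \<Delta> where "\<Delta> = E\<^sup>2 - 4 * z * (C - z)"
  define y where "y = (\<lambda>s. (E + s * sqrt \<Delta>) / (2 * z) - K2)"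
  have CE: "C\<^sup>2 - E\<^sup>2 = (1 + (1 + K2)\<^sup>2) * ((d * K2 + 1)\<^sup>2 - 1)"
    unfolding C_def E_def by algebra
  have \<Delta>: "0 < \<Delta>"
  proof -
    have "sqrt (C\<^sup>2 - E\<^sup>2) < C - 2 * z"
    proof -
      have "m_star2 A K2 n = real n * d + 1/2 * C - 1/2 * sqrt (C\<^sup>2 - E\<^sup>2)"
        unfolding CE unfolding m_star2_def C_def d_def ..
      then show ?thesis using small by (simp add: z_def d_def)
    qed
    moreover have nn: "0 \<le> C\<^sup>2 - E\<^sup>2" unfolding CE using K2 d by simp
    ultimately have "(sqrt (C\<^sup>2 - E\<^sup>2))\<^sup>2 < (C - 2 * z)\<^sup>2" by (intro power_strict_mono) auto
    then show ?thesis using nn by (simp add: \<Delta>_def power2_eq_square algebra_simps)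
  qed
  have G: "G_fun A K2 n m K1 = z * (K1 - y (- 1)) * (K1 - y 1)" for K1
  proof -
    have "4 * z * G_fun A K2 n m K1 = (2 * z * (K1 + K2) - E)\<^sup>2 - \<Delta>"
      unfolding G_fun_def \<Delta>_def E_def C_def z_def d_def by algebra
    also have "\<dots> = (2 * z * (K1 + K2) - E)\<^sup>2 - (sqrt \<Delta>)\<^sup>2" using \<Delta> by simp
    also have "\<dots> = (2 * z * (K1 - y (- 1))) * (2 * z * (K1 - y 1))"
      using z by (simp add: y_def power2_eq_square field_simps)
    finally have "4 * z * G_fun A K2 n m K1 = 4 * z * (z * (K1 - y (- 1)) * (K1 - y 1))" by (simp only: mult_ac)
    moreover have "4 * z \<noteq> 0" using z by simp
    ultimately show ?thesis using mult_left_cancel by blast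
  qed
  have less: "y (- 1) < y 1" using \<Delta> z by (simp add: y_def divide_strict_right_mono)
  have roots: "{K1. G_fun A K2 n m K1 = 0} = {y (- 1), y 1}" using z by (auto simp: G)
  have uniq: "p = y (- 1) \<and> q = y 1" if "p < q" "{K1. G_fun A K2 n m K1 = 0} = {p, q}" for p q
    using that less unfolding roots by (auto simp: doubleton_eq_iff)
  have Mm: "M_minus A K2 n m = y (- 1)"
    unfolding M_minus_def by (rule the_equality) (use less roots uniq in blast)+
  have Mp: "M_plus A K2 n m = y 1"
    unfolding M_plus_def by (rule the_equality) (use less roots uniq in blast)+
  have "G_fun A K2 n m 1 = K2 * ((z + 1) * (2 + K2) - d)"
    unfolding G_fun_def z_def d_def by algebra
  moreover have "0 < K2 * ((z + 1) * (2 + K2) - d)" using K2 L by (intro mult_pos_pos) auto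
  ultimately have "0 < z * ((1 - y (- 1)) * (1 - y 1))" using G[of 1] by (simp only: mult.assoc)
  then have same_side: "0 < (1 - y (- 1)) * (1 - y 1)" using z by (simp add: zero_less_mult_iff)
  have "(2 * z + 2) * (1 + K2) < d * (1 + K2)" using half K2 by (intro mult_strict_right_mono) auto
  then have "(2 * (1 + K2)) * z < E" using K2 by (simp add: E_def algebra_simps)
  then have "2 * (1 + K2) < E / z" using z by (simp only: pos_less_divide_eq)
  moreover have "y (- 1) + y 1 = E / z - 2 * K2" using z by (simp add: y_def field_simps)
  ultimately have sum: "2 < y (- 1) + y 1" by simp
  have "1 < y (- 1)"
  proof (rule ccontr)
    assume "\<not> 1 < y (- 1)"
    then have "(1 - y (- 1)) * (1 - y 1) \<le> 0" using sum by (intro mult_nonneg_nonpos) auto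
    then show False using same_side by simp
  qed
  moreover have "G_fun A K2 n m K1 < 0" if "y (- 1) < K1" "K1 < y 1" for K1
    using that z by (simp add: G mult_pos_neg)
  ultimately show ?thesis unfolding Mm Mp using roots less by blast
qed

section \<open>The transition at \<open>L\<close>\<close>

lemma eventually_at_right_interval:
  fixes L :: real
  assumes "eventually P (at_right L)" obtains \<delta> where "0 < \<delta>" "\<And>y. L < y \<Longrightarrow> y < L + \<delta> \<Longrightarrow> P y"
  using assms unfolding eventually_at_right_field by (metis add.commute diff_add_cancel diff_gt_0_iff_gt)

lemma eventually_at_left_interval:
  fixes L :: real
  assumes "eventually P (at_left L)" obtains \<delta> where "0 < \<delta>" "\<And>y. L - \<delta> < y \<Longrightarrow> y < L \<Longrightarrow> P y"
  using assms unfolding eventually_at_left_field by (metis diff_diff_eq2 add_diff_cancel_left' diff_gt_0_iff_gt)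

locale bifurcation =
  fixes a1 a2 c K2 L x :: real and n p :: nat
  assumes a: "0 < a1" "a1 < a2" and c: "0 < c" and K2: "0 < K2" "K2 < 1" and p: "1 \<le> p"
    and x_eq: "x = real p - real n * (a2 / a1 - 1)" and x: "0 < x"
    and L_eq: "L = L_bound (a2 / a1) K2 n (p - 1)"
begin

definition d where "d = a2 / a1 - 1"

text \<open>The common denominator of \<open>T\<close> and \<open>T\<^sub>2\<close>.\<close>

definition D where "D K1 = 1 - real p * (K1 - 1) + real n * (1 + K1 + K2)"

text \<open>The period of both solutions in the limit: at \<open>L\<close>, the difference \<open>a2 - a1\<close> of the delays is \<open>p\<close> periods.\<close>

definition T0 where "T0 = (a2 - a1) / real p"

lemma d: "0 < d" "a1 * d = a2 - a1" "x * (1 + L + K2) = d" "real p = x + real n * d"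
proof -
  show "0 < d" "a1 * d = a2 - a1" using a by (simp_all add: d_def field_simps)
  show "real p = x + real n * d" by (simp add: x_eq d_def)
  have "real (p - 1) - real n * (a2 / a1 - 1) + 1 = x" using p by (simp add: x_eq of_nat_diff)
  then have "L = d / x - (1 + K2)" unfolding L_eq L_bound_def by (simp add: d_def)
  then show "x * (1 + L + K2) = d" using x by simp
qed

lemma T0_pos: "0 < T0" using a p by (simp add: T0_def)

lemma D_at_L: "x * D L = real p * (1 + x * (2 + K2) - d)"
proof -
  have xL: "x * L = d - x - x * K2" using d(3) by (simp add: algebra_simps)
  have "x * D L = x - real p * (x * L - x) + real n * (x * (1 + L + K2))" by (simp add: D_def algebra_simps)
  then show ?thesis unfolding xL d(3) using d(4) by (simp add: algebra_simps)
qed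

lemma bi_T_mult: "D K1 \<noteq> 0 \<Longrightarrow> bi_T a1 a2 K2 n p K1 * D K1 = a1 * (1 + K1 + K2) + (a2 - a1) * (1 - K1)"
  by (simp add: bi_T_def D_def)

text \<open>
  The left side is \<open>\<theta> T\<^sub>2 D\<close>.  This identity decides on which side of \<open>L\<close> bimodal solutions live: \<open>\<theta> > 0\<close> requires that
  \<open>K1 - L\<close> and \<open>D\<close> have opposite signs.
\<close>

lemma excess:
  "D K1 \<noteq> 0 \<Longrightarrow> (a2 - a1 - real p * bi_T a1 a2 K2 n p K1) * D K1 = - (a1 * x * (K1 - L))"
  using bi_T_mult[of K1] d(2,3,4) unfolding D_def by algebra

text \<open>
  The right side is \<open>K2\<close> times the numerator of \<open>T\<close>, so that \<open>T\<^sub>2 = K2 T\<close> at \<open>L\<close>.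
\<close>

lemma H_at_L: "a1 * H_fun (a2 / a1) K2 n p L = K2 * (a1 * (1 + L + K2) + (a2 - a1) * (1 - L))"
proof -
  have "H_fun (a2 / a1) K2 n p L = x * (1 + L + K2) * (L + 2 * K2 - 1) - L * (d * (1 + K2) - K2)
      + K2 * (1 + K2) + d * (1 - K2)"
    unfolding H_fun_def x_eq d_def by (simp add: algebra_simps)
  then show ?thesis using d(2,3) by algebra
qed

lemma bi_T_at_L:
  assumes "D L \<noteq> 0"
  shows "bi_T a1 a2 K2 n p L = T0"
proof -
  have "a2 - a1 - real p * bi_T a1 a2 K2 n p L = 0" using excess[OF assms] assms by simp
  then show ?thesis using p by (simp add: T0_def field_simps)
qed

lemma bi_T_limit:
  assumes "D L \<noteq> 0"
  shows "(bi_T a1 a2 K2 n p \<longlongrightarrow> T0) (at L)"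
proof -
  have "(bi_T a1 a2 K2 n p \<longlongrightarrow> bi_T a1 a2 K2 n p L) (at L)"
    unfolding bi_T_def using assms by (intro tendsto_intros) (simp add: D_def)
  then show ?thesis by (simp add: bi_T_at_L[OF assms])
qed

lemma bi_T2_limit:
  assumes "D L \<noteq> 0"
  shows "(bi_T2 a1 a2 K2 n p \<longlongrightarrow> K2 * T0) (at L)"
proof -
  have "bi_T2 a1 a2 K2 n p L * D L = K2 * T0 * D L"
    using H_at_L bi_T_at_L[OF assms] bi_T_mult[OF assms] assms by (simp add: bi_T2_def D_def)
  then have "bi_T2 a1 a2 K2 n p L = K2 * T0" using assms by simp
  moreover have "(bi_T2 a1 a2 K2 n p \<longlongrightarrow> bi_T2 a1 a2 K2 n p L) (at L)"
    unfolding bi_T2_def H_fun_def using assms by (intro tendsto_intros) (simp add: D_def)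
  ultimately show ?thesis by simp
qed

lemma bi_T1_limit:
  assumes "D L \<noteq> 0"
  shows "(bi_T1 a1 a2 K2 n p \<longlongrightarrow> (1 - K2) * T0) (at L)"
  using tendsto_diff[OF bi_T_limit[OF assms] bi_T2_limit[OF assms]]
  by (simp add: bi_T1_def[abs_def] algebra_simps)

lemma bi_theta_limit:
  assumes "D L \<noteq> 0"
  shows "(bi_theta a1 a2 K2 n p \<longlongrightarrow> 0) (at L)"
proof -
  have "((\<lambda>K1. (a2 - a1 - real p * bi_T a1 a2 K2 n p K1) / bi_T2 a1 a2 K2 n p K1)
      \<longlongrightarrow> (a2 - a1 - real p * T0) / (K2 * T0)) (at L)"
    using K2 T0_pos by (intro tendsto_intros bi_T_limit bi_T2_limit assms) auto
  then show ?thesis using p by (simp add: bi_theta_def[abs_def] T0_def)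
qed

text \<open>
  Since \<open>\<theta> \<rightarrow> 0\<close> and \<open>T\<^sub>1 / T\<^sub>2 \<rightarrow> (1 - K2) / K2\<close>, each upper bound on \<open>\<theta>\<close> holds near \<open>L\<close> because its limit is positive; for the bound
  specific to \<open>K1 < 1\<close> this positivity is \<open>(1 - L) (1 - K2) < L K2\<close>, which is \<open>L + K2 > 1\<close> once more.
\<close>

lemma bimodal_near_L:
  assumes DL: "D L \<noteq> 0" and L: "0 < L" "1 < L + K2"
  shows "\<forall>\<^sub>F K1 in at L. (K1 - L) * D L < 0 \<longrightarrow> bimodal2_solution a1 a2 c K2 n p K1"
proof -
  let ?T1 = "bi_T1 a1 a2 K2 n p" and ?T2 = "bi_T2 a1 a2 K2 n p" and ?\<theta> = "bi_theta a1 a2 K2 n p"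
  define \<rho> where "\<rho> = (1 - K2) / K2"
  have \<rho>: "0 < \<rho>" using K2 by (simp add: \<rho>_def)
  note \<theta>_lim = bi_theta_limit[OF DL]
  have \<rho>_lim: "((\<lambda>K1. ?T1 K1 / ?T2 K1) \<longlongrightarrow> \<rho>) (at L)"
  proof -
    have "((\<lambda>K1. ?T1 K1 / ?T2 K1) \<longlongrightarrow> ((1 - K2) * T0) / (K2 * T0)) (at L)"
      using K2 T0_pos by (intro tendsto_intros bi_T1_limit bi_T2_limit DL) auto
    then show ?thesis using T0_pos by (simp add: \<rho>_def)
  qed
  have below: "\<forall>\<^sub>F K1 in at L. ?\<theta> K1 < g K1" if "(g \<longlongrightarrow> l) (at L)" "0 < l" for g l
  proof -
    have "((\<lambda>K1. g K1 - ?\<theta> K1) \<longlongrightarrow> l - 0) (at L)" by (intro tendsto_diff that \<theta>_lim)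
    then have "\<forall>\<^sub>F K1 in at L. 0 < g K1 - ?\<theta> K1" using that by (intro order_tendstoD(1)) auto
    then show ?thesis by eventually_elim simp
  qed
  have e1: "\<forall>\<^sub>F K1 in at L. ?\<theta> K1 < (1 - 1 / (K1 + K2)) * (?T1 K1 / ?T2 K1)"
    using L \<rho> by (intro below[of _ "(1 - 1 / (L + K2)) * \<rho>"] tendsto_intros \<rho>_lim mult_pos_pos) auto
  have e2: "\<forall>\<^sub>F K1 in at L. ?\<theta> K1 < (1 - K1 / (2 * K1 + K2 - 1)) * (?T1 K1 / ?T2 K1)"
    using L \<rho> by (intro below[of _ "(1 - L / (2 * L + K2 - 1)) * \<rho>"] tendsto_intros \<rho>_lim mult_pos_pos) auto
  have e3: "\<forall>\<^sub>F K1 in at L. ?\<theta> K1 < 1 - (1 - K1) / K1 * (?T1 K1 / ?T2 K1)"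
  proof (intro below[of _ "1 - (1 - L) / L * \<rho>"] tendsto_intros \<rho>_lim)
    have "(1 - L) * (1 - K2) < L * K2" using L by (simp add: algebra_simps)
    then show "0 < 1 - (1 - L) / L * \<rho>" using L K2 by (simp add: \<rho>_def field_simps)
  qed (use L in auto)
  have e4: "\<forall>\<^sub>F K1 in at L. ?\<theta> K1 < 1" by (intro below[of _ 1] tendsto_intros) auto
  have e5: "\<forall>\<^sub>F K1 in at L. 0 < ?T2 K1"
    using K2 T0_pos by (intro order_tendstoD(1)[OF bi_T2_limit[OF DL]]) auto
  have "((\<lambda>K1. D K1 * D L) \<longlongrightarrow> D L * D L) (at L)" unfolding D_def by (intro tendsto_intros)
  then have e6: "\<forall>\<^sub>F K1 in at L. 0 < D K1 * D L"
    using order_tendstoD(1)[of "\<lambda>K1. D K1 * D L" "D L * D L" "at L" 0] DL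
    by (simp add: zero_less_mult_iff linorder_neq_iff[symmetric])
  have e7: "\<forall>\<^sub>F K1 in at L. 0 < K1" "\<forall>\<^sub>F K1 in at L. 1 - K2 < K1"
    using L by (auto intro!: order_tendstoD(1)[OF tendsto_ident_at])
  show ?thesis
    using e1 e2 e3 e4 e5 e6 e7
  proof eventually_elim
    case (elim K1)
    show ?case
    proof
      assume side: "(K1 - L) * D L < 0"
      have DK: "D K1 \<noteq> 0" using elim by auto
      have "(K1 - L) * D K1 < 0" using side elim(6) by (auto simp: mult_less_0_iff zero_less_mult_iff)
      then have "a1 * x * ((K1 - L) * D K1) < 0" using a x by (simp add: mult_pos_neg)
      have "?\<theta> K1 * ?T2 K1 = a2 - a1 - real p * bi_T a1 a2 K2 n p K1"
        using elim(5) by (simp add: bi_theta_def)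
      then have "?\<theta> K1 * ?T2 K1 * D K1 = - (a1 * x * (K1 - L))" using excess[OF DK] by simp
      then have "?\<theta> K1 * ?T2 K1 * (D K1)\<^sup>2 = - (a1 * x * ((K1 - L) * D K1))"
        by (simp add: power2_eq_square mult.assoc[symmetric])
      with \<open>a1 * x * _ < 0\<close> have "0 < ?\<theta> K1 * ?T2 K1 * (D K1)\<^sup>2" by simp
      then have "0 < ?\<theta> K1" using elim(5) DK by (simp add: zero_less_mult_iff)
      then show "bimodal2_solution a1 a2 c K2 n p K1"
        using elim DK a c K2 by (intro bimodal2_solutionI) (auto simp: D_def)
    qed
  qed
qed

lemma bimodal_left_leg:
  assumes "0 < D L" "0 < L" "1 < L + K2"
  obtains \<delta> where "0 < \<delta>" "leg (bimodal2_solution a1 a2 c K2 n p) {L - \<delta><..<L}"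
proof -
  have "\<forall>\<^sub>F K1 in at_left L. (K1 - L) * D L < 0 \<longrightarrow> bimodal2_solution a1 a2 c K2 n p K1"
    using bimodal_near_L assms by (auto intro: filter_leD[OF at_le[of "{..<L}" UNIV L]])
  moreover have "\<forall>\<^sub>F K1 in at_left L. K1 < L" by (simp add: eventually_at_filter)
  ultimately have "\<forall>\<^sub>F K1 in at_left L. bimodal2_solution a1 a2 c K2 n p K1"
    by eventually_elim (simp add: assms mult_neg_pos)
  then show thesis using that by (elim eventually_at_left_interval) (auto simp: leg_def)
qed

lemma unimodal_near_L:
  assumes "1 \<le> L"
  shows "\<forall>\<^sub>F K1 in at_right L. unimodal_solution a1 a2 c K2 n (p - 1) K1"
proof -
  have x': "real (p - 1) + 1 - real n * (a2 / a1 - 1) = x" using p by (simp add: x_eq of_nat_diff)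
  have pos: "0 < real (p - 1) + 1 - real n * (a2 / a1 - 1)" unfolding x' by (rule x)
  have "\<forall>\<^sub>F K1 in at_right L. G_fun (a2 / a1) K2 n (p - 1) K1 < 0"
    using eventually_G_negative[of K2 "p - 1" n "a2 / a1"] K2 x assms unfolding x' L_eq by simp
  moreover have "\<forall>\<^sub>F K1 in at_right L. L < K1" by (simp add: eventually_at_filter)
  ultimately show ?thesis
  proof eventually_elim
    case (elim K1)
    then show ?case using assms
      by (intro unimodal_solution_if_G_negative[OF a c K2(1) pos]) (simp_all add: L_eq)
  qed
qed

lemma uni_T_limit:
  assumes "0 < L"
  shows "(uni_T a1 a2 K2 n (p - 1) \<longlongrightarrow> T0) (at L)"
proof -
  have pos: "0 < 1 + real p * K2 + real n * (1 + L + K2)"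
    using assms K2 by (intro add_pos_nonneg) auto
  have "uni_T a1 a2 K2 n (p - 1) L = (a1 * (1 + L + K2) + (a2 - a1) * K2) / (1 + real p * K2 + real n * (1 + L + K2))"
    using p by (simp add: uni_T_def of_nat_diff)
  also have "\<dots> = T0"
  proof -
    have "(a1 * (1 + L + K2) + (a2 - a1) * K2) * real p = (a2 - a1) * (1 + real p * K2 + real n * (1 + L + K2))"
      using d(2,3,4) by algebra
    then show ?thesis using pos p by (simp add: T0_def frac_eq_eq)
  qed
  finally have "uni_T a1 a2 K2 n (p - 1) L = T0" .
  moreover have "(uni_T a1 a2 K2 n (p - 1) \<longlongrightarrow> uni_T a1 a2 K2 n (p - 1) L) (at L)"
    unfolding uni_T_def using pos p by (intro tendsto_intros) (simp add: of_nat_diff)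
  ultimately show ?thesis by simp
qed

lemma coincide_at_L:
  assumes DL: "D L \<noteq> 0" and L: "0 < L" and F: "F \<le> at L" "F' \<le> at L"
  shows "coincide_in_limit (uni_T a1 a2 K2 n (p - 1)) (uni_profile a1 a2 c K2 n (p - 1)) F
           (bi_T a1 a2 K2 n p) (bi_profile a1 a2 c K2 n p) F'"
proof -
  let ?b = "- a1 + real n * T0"
  have uT: "(uni_T a1 a2 K2 n (p - 1) \<longlongrightarrow> T0) F" using uni_T_limit[OF L] F(1) by (rule tendsto_mono[rotated])
  note lims = bi_T_limit[OF DL] bi_T1_limit[OF DL] bi_T2_limit[OF DL] bi_theta_limit[OF DL]
  note bT = lims[THEN tendsto_mono[OF F(2)]]
  have u: "uniform_limit C (uni_profile a1 a2 c K2 n (p - 1)) (polyline (sawtooth_nodes T0 ?b c)) F"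
    if "compact C" for C
    unfolding uni_profile_sawtooth using c compact_imp_bounded[OF that]
    by (intro polyline_uniform_limit sawtooth_nodes_tendsto tendsto_intros uT) auto
  have b: "uniform_limit C (bi_profile a1 a2 c K2 n p)
      (polyline (two_tooth_nodes ((1 - K2) * T0) (K2 * T0) (0 * (K2 * T0)) ?b c)) F'"
    if "compact C" for C
    unfolding bi_profile_two_tooth using c compact_imp_bounded[OF that]
    by (intro polyline_uniform_limit two_tooth_nodes_tendsto tendsto_intros bT) auto
  have "range (polyline (sawtooth_nodes T0 ?b c))
      = range (polyline (two_tooth_nodes ((1 - K2) * T0) (K2 * T0) (0 * (K2 * T0)) ?b c))"
    using range_two_tooth_degenerate[of "(1 - K2) * T0" "K2 * T0" ?b c] K2 T0_pos
    by (simp add: algebra_simps)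
  then show ?thesis unfolding coincide_in_limit_def using uT bT(1) u b by blast
qed

end

lemma m_zero_eq: "m_zero A n = \<lfloor>real n * (A - 1)\<rfloor>"
  unfolding m_zero_def by (rule the_equality) linarith+

text \<open>
  The hypotheses of each case are first rewritten in terms of \<open>x (2 + K2)\<close>: it is compared with \<open>A - 2\<close>, which gives the sign
  of \<open>D(L)\<close>, and with \<open>A - 1\<close>, which tells whether \<open>L \<ge> 1\<close>.  In (iii), \<open>2 x < A - 1\<close> says \<open>L > 1 - K2\<close>.
\<close>

theorem theorem3p4:
  fixes a1 a2 c A K2 L :: real and n p :: nat
  assumes "0 < a1" and "a1 < a2" and "0 < c" and "A = a2 / a1"
    and "0 < K2" and "K2 < 1" and "1 \<le> p"
    and "L = L_bound A K2 n (p - 1)"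
  shows
    "(of_int (m_zero A n) + 1 \<le> real p \<and> real p < m_star A K2 n + (1 + K2) / (2 + K2)
       \<longrightarrow> (\<exists>\<delta>>0.
             leg (unimodal_solution a1 a2 c K2 n (p - 1)) {L<..<L + \<delta>} \<and>
             leg (bimodal2_solution a1 a2 c K2 n p) {L<..<L + \<delta>} \<and>
             coincide_in_limit
               (uni_T a1 a2 K2 n (p - 1)) (uni_profile a1 a2 c K2 n (p - 1)) (at_right L)
               (bi_T a1 a2 K2 n p) (bi_profile a1 a2 c K2 n p) (at_right L)))
     \<and>
     (real n * (A - 1) < real p \<and>
      m_star A K2 n + (1 + K2) / (2 + K2) < real p \<and> real p \<le> m_star A K2 n + 1
       \<longrightarrow> (\<exists>\<delta>>0.
             leg (unimodal_solution a1 a2 c K2 n (p - 1)) {L<..<L + \<delta>} \<and>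
             leg (bimodal2_solution a1 a2 c K2 n p) {L - \<delta><..<L} \<and>
             coincide_in_limit
               (uni_T a1 a2 K2 n (p - 1)) (uni_profile a1 a2 c K2 n (p - 1)) (at_right L)
               (bi_T a1 a2 K2 n p) (bi_profile a1 a2 c K2 n p) (at_left L)))
     \<and>
     (real n * (A - 1) < real p - 1 \<and>
      m_star A K2 n + 1 < real p \<and>
      real p < min (m_star2 A K2 n + 1) ((real n + 1/2) * (A - 1))
       \<longrightarrow> {K1. G_fun A K2 n (p - 1) K1 = 0} = {M_minus A K2 n (p - 1), M_plus A K2 n (p - 1)} \<and>
           1 - K2 < L \<and> L < 1 \<and> 1 < M_minus A K2 n (p - 1) \<and>
           M_minus A K2 n (p - 1) < M_plus A K2 n (p - 1) \<and>
           (\<exists>\<delta>>0.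
             leg (unimodal_solution a1 a2 c K2 n (p - 1))
               {M_minus A K2 n (p - 1)<..<M_plus A K2 n (p - 1)} \<and>
             leg (bimodal2_solution a1 a2 c K2 n p) {L - \<delta><..<L} \<and>
             {M_minus A K2 n (p - 1)<..<M_plus A K2 n (p - 1)} \<inter> {L - \<delta><..<L} = {}))"
proof -
  define x where "x = real p - real n * (A - 1)"
  have bif: "bifurcation a1 a2 c K2 L x n p" if "0 < x"
    using assms that by unfold_locales (auto simp: x_def)
  have K2: "0 < 2 + K2" using assms by simp
  have "(A - 3 - K2) / (2 + K2) + 1 = (A - 1) / (2 + K2)" using K2 by (simp add: field_simps)
  moreover have "(A - 3 - K2) / (2 + K2) + (1 + K2) / (2 + K2) = (A - 2) / (2 + K2)"
    by (simp add: add_divide_distrib[symmetric])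
  ultimately have "m_star A K2 n + 1 = real n * (A - 1) + (A - 1) / (2 + K2)"
    "m_star A K2 n + (1 + K2) / (2 + K2) = real n * (A - 1) + (A - 2) / (2 + K2)"
    by (simp_all add: m_star_def)
  then have thresholds:
    "real p \<le> m_star A K2 n + 1 \<longleftrightarrow> x * (2 + K2) \<le> A - 1"
    "m_star A K2 n + 1 < real p \<longleftrightarrow> A - 1 < x * (2 + K2)"
    "real p < m_star A K2 n + (1 + K2) / (2 + K2) \<longleftrightarrow> x * (2 + K2) < A - 2"
    "m_star A K2 n + (1 + K2) / (2 + K2) < real p \<longleftrightarrow> A - 2 < x * (2 + K2)"
    using pos_le_divide_eq[OF K2, of x "A - 1"] pos_divide_less_eq[OF K2, of "A - 1" x]
      pos_less_divide_eq[OF K2, of x "A - 2"] pos_divide_less_eq[OF K2, of "A - 2" x]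
    by (auto simp: x_def)
  have L_x: "x * (L + 1 + K2) = A - 1" if "0 < x"
    using that assms by (simp add: x_def L_bound_def of_nat_diff)
  have L1: "1 \<le> L \<longleftrightarrow> x * (2 + K2) \<le> A - 1" if "0 < x"
  proof -
    have "1 \<le> L \<longleftrightarrow> x * (2 + K2) \<le> x * (L + 1 + K2)" using that by simp
    then show ?thesis using L_x[OF that] by simp
  qed
  have D_sign: "x * bifurcation.D K2 n p L = real p * (1 + x * (2 + K2) - (A - 1))" if "0 < x"
    using bifurcation.D_at_L[OF bif[OF that]] bifurcation.d_def[OF bif[OF that]] assms by simp
  have at: "at_right L \<le> at L" "at_left L \<le> at L" by (simp_all add: at_le)
  show ?thesis
  proof (intro conjI[of "_ \<longrightarrow> _"] impI, goal_cases)
    case 1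
    have "real n * (A - 1) < of_int (m_zero A n) + 1" unfolding m_zero_eq by linarith
    then have x0: "0 < x" using 1 by (simp add: x_def)
    interpret bifurcation a1 a2 c K2 L x n p by (rule bif[OF x0])
    have le: "x * (2 + K2) < A - 2" using 1 thresholds by blast
    then have "1 \<le> L" using L1[OF x0] by simp
    have "x * D L < 0" unfolding D_sign[OF x0] using le assms by (intro mult_pos_neg) auto
    then have DL: "D L < 0" using x0 by (simp add: mult_less_0_iff)
    have "\<forall>\<^sub>F K1 in at_right L. (K1 - L) * D L < 0 \<longrightarrow> bimodal2_solution a1 a2 c K2 n p K1"
      using bimodal_near_L DL \<open>1 \<le> L\<close> assms at(1) by (auto intro: filter_leD)
    moreover have "\<forall>\<^sub>F K1 in at_right L. L < K1" by (simp add: eventually_at_filter)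
    ultimately have "\<forall>\<^sub>F K1 in at_right L. bimodal2_solution a1 a2 c K2 n p K1"
      by eventually_elim (simp add: DL mult_pos_neg)
    with unimodal_near_L[OF \<open>1 \<le> L\<close>]
    have "\<forall>\<^sub>F K1 in at_right L. unimodal_solution a1 a2 c K2 n (p - 1) K1 \<and> bimodal2_solution a1 a2 c K2 n p K1"
      by eventually_elim simp
    then obtain \<delta> where "0 < \<delta>" "leg (unimodal_solution a1 a2 c K2 n (p - 1)) {L<..<L + \<delta>}"
      "leg (bimodal2_solution a1 a2 c K2 n p) {L<..<L + \<delta>}"
      by (elim eventually_at_right_interval) (auto simp: leg_def)
    then show ?case using coincide_at_L[OF _ _ at(1) at(1)] DL \<open>1 \<le> L\<close> by auto
  next
    case 2
    then have x0: "0 < x" by (simp add: x_def)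
    interpret bifurcation a1 a2 c K2 L x n p by (rule bif[OF x0])
    have "1 \<le> L" using 2 thresholds L1[OF x0] by blast
    have "0 < x * D L" unfolding D_sign[OF x0] using 2 thresholds assms by (intro mult_pos_pos) auto
    then have DL: "0 < D L" using x0 by (simp add: zero_less_mult_iff)
    obtain \<delta>1 where \<delta>1: "0 < \<delta>1" "leg (unimodal_solution a1 a2 c K2 n (p - 1)) {L<..<L + \<delta>1}"
      using unimodal_near_L[OF \<open>1 \<le> L\<close>] by (elim eventually_at_right_interval) (auto simp: leg_def)
    obtain \<delta>2 where \<delta>2: "0 < \<delta>2" "leg (bimodal2_solution a1 a2 c K2 n p) {L - \<delta>2<..<L}"
      using bimodal_left_leg[OF DL] \<open>1 \<le> L\<close> K2 by auto
    have "leg (unimodal_solution a1 a2 c K2 n (p - 1)) {L<..<L + min \<delta>1 \<delta>2}"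
      "leg (bimodal2_solution a1 a2 c K2 n p) {L - min \<delta>1 \<delta>2<..<L}"
      using \<delta>1 \<delta>2 by (auto simp: leg_def)
    then show ?case using \<delta>1(1) \<delta>2(1) coincide_at_L[OF _ _ at] DL \<open>1 \<le> L\<close>
      by (intro exI[of _ "min \<delta>1 \<delta>2"]) auto
  next
    case 3
    then have x0: "0 < x" by (simp add: x_def)
    interpret bifurcation a1 a2 c K2 L x n p by (rule bif[OF x0])
    have DL: "0 < D L"
    proof -
      have "0 < x * D L" unfolding D_sign[OF x0] using 3 thresholds assms by (intro mult_pos_pos) auto
      then show ?thesis using x0 by (simp add: zero_less_mult_iff)
    qed
    have L_less: "L < 1" using 3 thresholds L1[OF x0] by auto
    have "real p < (real n + 1 / 2) * (A - 1)" using 3 by simp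
    then have half: "x < (A - 1) / 2" unfolding x_def distrib_right by linarith
    have "2 * x < (L + 1 + K2) * x" using half L_x[OF x0] by (simp add: mult.commute)
    then have L_greater: "1 - K2 < L" using x0 by simp
    have z: "real (p - 1) - real n * (A - 1) + 1 = x" using p by (simp add: x_def of_nat_diff)
    then have pos: "0 < real (p - 1) + 1 - real n * (a2 / a1 - 1)" using x0 assms(4) by simp
    have roots: "{K1. G_fun A K2 n (p - 1) K1 = 0} = {M_minus A K2 n (p - 1), M_plus A K2 n (p - 1)} \<and>
        1 < M_minus A K2 n (p - 1) \<and> M_minus A K2 n (p - 1) < M_plus A K2 n (p - 1) \<and>
        (\<forall>K1. M_minus A K2 n (p - 1) < K1 \<and> K1 < M_plus A K2 n (p - 1) \<longrightarrow> G_fun A K2 n (p - 1) K1 < 0)"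
      using 3 thresholds assms half p by (intro G_roots) (auto simp: z x_def of_nat_diff)
    then have uni: "leg (unimodal_solution a1 a2 c K2 n (p - 1)) {M_minus A K2 n (p - 1)<..<M_plus A K2 n (p - 1)}"
      using assms L_less unfolding leg_def
      by (intro ballI unimodal_solution_if_G_negative[OF a c K2(1) pos]) auto
    obtain \<delta> where \<delta>: "0 < \<delta>" "leg (bimodal2_solution a1 a2 c K2 n p) {L - \<delta><..<L}"
      using bimodal_left_leg[OF DL] L_greater K2 assms by auto
    have "{M_minus A K2 n (p - 1)<..<M_plus A K2 n (p - 1)} \<inter> {L - \<delta><..<L} = {}"
      using roots L_less by auto
    then have "\<exists>\<delta>>0. leg (unimodal_solution a1 a2 c K2 n (p - 1)) {M_minus A K2 n (p - 1)<..<M_plus A K2 n (p - 1)} \<and>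
        leg (bimodal2_solution a1 a2 c K2 n p) {L - \<delta><..<L} \<and>
        {M_minus A K2 n (p - 1)<..<M_plus A K2 n (p - 1)} \<inter> {L - \<delta><..<L} = {}"
      using uni \<delta> by blast
    then show ?case using roots L_less L_greater by blast
  qed
qed

end
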